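(* For every integer $k\geq 0$ there exist, for every $n\geq 2$, total Boolean functions $f_{k,n}:\{0,1\}^{N_k}\to\{0,1\}$ such that, as $n\to\infty$ with $k$ fixed, $R(f_{k,n})=\widetilde{\Omega}(n^{2k+1})$ and $\mathrm{UC}(f_{k,n})=\widetilde{O}(n^{k+1})$, where the $\widetilde{\Omega},\widetilde{O}$ notation hides factors polylogarithmic in $n$ (and constants depending on $k$). Consequently there is a sequence of total Boolean functions $f$ with $\mathrm{UC}(f)\to\infty$ and $R(f)\geq \mathrm{UC}(f)^{2-o(1)}$.
   Context: $R(f)$ denotes bounded-error randomized query complexity (minimum worst-case number of input-bit queries of a randomized algorithm that outputs $f(x)$ with probability at least $2/3$ on every input $x$). A certificate for input $x$ is a partial assignment consistent with $x$ such that all inputs consistent with it have the same $f$-value as $x$. $\mathrm{UC}_b(f)$, for $b\in\{0,1\}$, is the minimum $w$ such that there is a set of $b$-certificates, each fixing at most $w$ variables, with every input $x$ satisfying $f(x)=b$ consistent with exactly one of them; $\mathrm{UC}(f)=\max\{\mathrm{UC}_0(f),\mathrm{UC}_1(f)\}$. *)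

theory Defs
  imports "HOL-Probability.Probability" "HOL-Library.Landau_Symbols"
begin

definition cube :: "nat \<Rightarrow> (nat \<Rightarrow> bool) set" where
  "cube N = {..<N} \<rightarrow>\<^sub>E UNIV"

definition bool_funs :: "nat \<Rightarrow> ((nat \<Rightarrow> bool) \<Rightarrow> bool) set" where
  "bool_funs N = cube N \<rightarrow>\<^sub>E UNIV"

datatype dtree = Answer bool | Query nat dtree dtree

primrec run :: "dtree \<Rightarrow> (nat \<Rightarrow> bool) \<Rightarrow> bool" where
  "run (Answer b) x = b"
| "run (Query i t0 t1) x = (if x i then run t1 x else run t0 x)"

primrec queries :: "dtree \<Rightarrow> (nat \<Rightarrow> bool) \<Rightarrow> nat" where
  "queries (Answer b) x = 0"
| "queries (Query i t0 t1) x = Suc (if x i then queries t1 x else queries t0 x)"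

primrec queried_vars :: "dtree \<Rightarrow> nat set" where
  "queried_vars (Answer b) = {}"
| "queried_vars (Query i t0 t1) = insert i (queried_vars t0 \<union> queried_vars t1)"

text \<open>
  A randomized algorithm is a probability distribution on deterministic decision trees.
  Since there are only countably many such trees, \<^typ>\<open>dtree pmf\<close> covers all distributions.
  The query bound is a worst case over both the input and the internal randomness.
\<close>

definition rand_alg :: "nat \<Rightarrow> nat \<Rightarrow> dtree pmf \<Rightarrow> bool" where
  "rand_alg N d A \<longleftrightarrow>
     (\<forall>t\<in>set_pmf A. queried_vars t \<subseteq> {..<N} \<and> (\<forall>x\<in>cube N. queries t x \<le> d))"

definition computes_bounded_error ::
    "nat \<Rightarrow> dtree pmf \<Rightarrow> ((nat \<Rightarrow> bool) \<Rightarrow> bool) \<Rightarrow> bool" where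
  "computes_bounded_error N A f \<longleftrightarrow>
     (\<forall>x\<in>cube N. measure_pmf.prob A {t. run t x = f x} \<ge> 2 / 3)"

definition RQ :: "nat \<Rightarrow> ((nat \<Rightarrow> bool) \<Rightarrow> bool) \<Rightarrow> nat" where
  "RQ N f = (LEAST d. \<exists>A. rand_alg N d A \<and> computes_bounded_error N A f)"

definition consistent :: "(nat \<rightharpoonup> bool) \<Rightarrow> (nat \<Rightarrow> bool) \<Rightarrow> bool" where
  "consistent p x \<longleftrightarrow> (\<forall>i b. p i = Some b \<longrightarrow> x i = b)"

definition certificate ::
    "nat \<Rightarrow> ((nat \<Rightarrow> bool) \<Rightarrow> bool) \<Rightarrow> (nat \<Rightarrow> bool) \<Rightarrow> (nat \<rightharpoonup> bool) \<Rightarrow> bool" where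
  "certificate N f x p \<longleftrightarrow>
     dom p \<subseteq> {..<N} \<and> consistent p x \<and> (\<forall>y\<in>cube N. consistent p y \<longrightarrow> f y = f x)"

definition b_certificate ::
    "nat \<Rightarrow> ((nat \<Rightarrow> bool) \<Rightarrow> bool) \<Rightarrow> bool \<Rightarrow> (nat \<rightharpoonup> bool) \<Rightarrow> bool" where
  "b_certificate N f b p \<longleftrightarrow> (\<exists>x\<in>cube N. f x = b \<and> certificate N f x p)"

definition UC_side :: "bool \<Rightarrow> nat \<Rightarrow> ((nat \<Rightarrow> bool) \<Rightarrow> bool) \<Rightarrow> nat" where
  "UC_side b N f = (LEAST w. \<exists>C.
     (\<forall>p\<in>C. b_certificate N f b p \<and> card (dom p) \<le> w) \<and>
     (\<forall>x\<in>cube N. f x = b \<longrightarrow> (\<exists>!p. p \<in> C \<and> consistent p x)))"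

definition UC :: "nat \<Rightarrow> ((nat \<Rightarrow> bool) \<Rightarrow> bool) \<Rightarrow> nat" where
  "UC N f = max (UC_side False N f) (UC_side True N f)"

definition soft_bigo :: "(nat \<Rightarrow> real) \<Rightarrow> (nat \<Rightarrow> real) set" where
  "soft_bigo g = {f. \<exists>c::nat. f \<in> O(\<lambda>n. g n * ln (real n) ^ c)}"

definition soft_bigomega :: "(nat \<Rightarrow> real) \<Rightarrow> (nat \<Rightarrow> real) set" where
  "soft_bigomega g = {f. \<exists>c::nat. f \<in> \<Omega>(\<lambda>n. g n / ln (real n) ^ c)}"

end

theory Submission
  imports Defs "HOL-Real_Asymp.Real_Asymp" "HOL-Library.Log_Nat"
begin

text \<open>
  Starting from a single bit \<open>g\<^sub>0\<close>, let \<open>f\<^sub>k = NAND\<^sub>n \<circ> g\<^sub>k\<close>, and let \<open>g\<^sub>k\<^sub>+\<^sub>1\<close> be the cheat sheet version of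
  \<open>NAND\<^sub>n \<circ> f\<^sub>k\<close> on logarithmically many copies. Each NAND multiplies the randomized complexity by
  \<open>n\<close>, while two of them multiply ordinary certificates by \<open>n\<close> only. A cheat sheet names
  the positions of ordinary certificates of all copies, so it turns these into unambiguous
  1-certificates; the unambiguous 0-certificates of \<open>g\<^sub>k\<close> stay larger by a factor \<open>n\<close>, which the
  outer NAND of \<open>f\<^sub>k\<close> absorbs, because it needs only one of them.

  The lower bounds carry a pair of distributions on 1- and 0-inputs which no shallow tree tells
  apart. For NAND, plant a 0-input in a random block: on average that block receives only a
  \<open>1/n\<close> fraction of the queries. For cheat sheets, a tree can only win by querying the one correct
  sheet out of \<open>2\<^sup>c\<close>; by a hybrid argument over the \<open>c\<close> copies it can hardly know which one this is.
  Advantages inverse polylogarithmic in \<open>n\<close> absorb the losses of all \<open>k\<close> rounds.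
\<close>

subsection \<open>Decision trees\<close>

lemma run_cong:
  assumes "\<And>i. i \<in> queried_vars t \<Longrightarrow> x i = y i"
  shows "run t x = run t y" "queries t x = queries t y"
  using assms by (induction t) auto

primrec neg_tree :: "dtree \<Rightarrow> dtree" where
  "neg_tree (Answer b) = Answer (\<not> b)"
| "neg_tree (Query i t0 t1) = Query i (neg_tree t0) (neg_tree t1)"

lemma neg_tree [simp]:
  "run (neg_tree t) x = (\<not> run t x)" "queries (neg_tree t) x = queries t x"
  "queried_vars (neg_tree t) = queried_vars t"
  by (induction t) auto

text \<open>The sets \<open>P\<close> will be cheat sheets. The new tree stops just before the first
  query into \<open>P\<close>, so it never reads \<open>P\<close> and its answer cannot depend on
  what is written there.\<close>

primrec touch :: "nat set \<Rightarrow> dtree \<Rightarrow> dtree" where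
  "touch P (Answer b) = Answer False"
| "touch P (Query v t0 t1) = (if v \<in> P then Answer True else Query v (touch P t0) (touch P t1))"

lemma queries_touch: "queries (touch P t) x \<le> queries t x"
  by (induction t) auto

text \<open>The computations of \<open>t\<close> on \<open>x\<close> and \<open>y\<close> agree
  until a variable of \<open>P\<close> is queried, and at that moment \<open>touch P t\<close>
  accepts.\<close>

lemma run_touch:
  assumes "run t x" "\<And>v. v \<notin> P \<Longrightarrow> x v = y v"
  shows "run t y \<or> run (touch P t) y"
  using assms by (induction t) (auto split: if_splits)

text \<open>Each query lies in at most one of the disjoint sets, so it accounts for at most one
  summand.\<close>

lemma sum_touch_le:
  assumes "finite I" "disjoint_family_on P I"
  shows "(\<Sum>l\<in>I. of_bool (run (touch (P l) t) x)) \<le> queries t x"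
proof (induction t)
  case (Query v t0 t1)
  let ?t = "if x v then t1 else t0"
  have IH: "(\<Sum>l\<in>I. of_bool (run (touch (P l) ?t) x)) \<le> queries ?t x"
    using Query by auto
  have "(\<Sum>l\<in>I. of_bool (run (touch (P l) (Query v t0 t1)) x))
     \<le> (\<Sum>l\<in>I. of_bool (run (touch (P l) ?t) x) + of_bool (v \<in> P l) :: nat)"
    by (intro sum_mono) auto
  also have "\<dots> = (\<Sum>l\<in>I. of_bool (run (touch (P l) ?t) x)) + (\<Sum>l\<in>I. of_bool (v \<in> P l))"
    by (rule sum.distrib)
  also have "(\<Sum>l\<in>I. of_bool (v \<in> P l) :: nat) = card {l\<in>I. v \<in> P l}"
    using assms(1) by (simp add: of_bool_def sum.If_cases Int_def)
  also have "card {l\<in>I. v \<in> P l} \<le> 1"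
    using assms by (auto simp: card_le_Suc0_iff_eq disjoint_family_on_def)
  finally show ?case using IH by auto
qed simp

text \<open>The variables beyond the \<open>c\<close> blocks will hold the cheat sheets, all blank in \<open>join\<close>.\<close>

definition blk :: "nat \<Rightarrow> nat \<Rightarrow> (nat \<Rightarrow> bool) \<Rightarrow> nat \<Rightarrow> bool" where
  "blk N i x = (\<lambda>j. x (i * N + j))"

definition join :: "nat \<Rightarrow> nat \<Rightarrow> (nat \<Rightarrow> nat \<Rightarrow> bool) \<Rightarrow> nat \<Rightarrow> bool" where
  "join c N B = (\<lambda>v. v < c * N \<and> B (v div N) (v mod N))"

primrec blk_queries :: "nat \<Rightarrow> nat \<Rightarrow> dtree \<Rightarrow> (nat \<Rightarrow> bool) \<Rightarrow> nat" where
  "blk_queries N i (Answer b) x = 0"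
| "blk_queries N i (Query v t0 t1) x =
     of_bool (v div N = i) + (if x v then blk_queries N i t1 x else blk_queries N i t0 x)"

lemma sum_blk_queries: "(\<Sum>i<n. blk_queries N i t x) \<le> queries t x"
proof (induction t)
  case (Query v t0 t1)
  have "(\<Sum>i<n. of_bool (v div N = i) :: nat) \<le> 1"
    by (simp add: of_bool_def)
  with Query show ?case by (auto simp: sum.distrib)
qed simp

lemma blk_queries_le: "blk_queries N i t x \<le> queries t x"
  by (induction t) auto

text \<open>Simulates a tree on block \<open>i\<close>, the other blocks being fixed to \<open>B\<close>. Stopping after \<open>r\<close> queries
  only ever turns the answer into \<open>True\<close>, so the error is one-sided (\<open>cut_ge\<close>, \<open>cut_le\<close>).\<close>

primrec cut :: "nat \<Rightarrow> nat \<Rightarrow> nat \<Rightarrow> (nat \<Rightarrow> nat \<Rightarrow> bool) \<Rightarrow> dtree \<Rightarrow> nat \<Rightarrow> dtree" where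
  "cut c N i B (Answer b) = (\<lambda>r. Answer b)"
| "cut c N i B (Query v t0 t1) = (\<lambda>r.
     if v < c * N \<and> v div N = i then
       (case r of 0 \<Rightarrow> Answer True
        | Suc r' \<Rightarrow> Query (v mod N) (cut c N i B t0 r') (cut c N i B t1 r'))
     else if join c N B v then cut c N i B t1 r else cut c N i B t0 r)"

lemma queries_cut: "queries (cut c N i B t r) x \<le> r"
  by (induction t arbitrary: r) (auto split: nat.split)

lemma queried_vars_cut: "queried_vars (cut c N i B t r) \<subseteq> {..<N}"
proof (induction t arbitrary: r)
  case (Query v t0 t1)
  have "v mod N < N" if "v < c * N"
    using that by (cases "N = 0") auto
  with Query show ?case by (auto split: nat.split)
qed simp

lemma join_upd: "\<not> (v < c * N \<and> v div N = i) \<Longrightarrow> join c N (B(i := y)) v = join c N B v"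
  by (auto simp: join_def)

lemma join_upd': "v < c * N \<Longrightarrow> join c N (B(v div N := y)) v = y (v mod N)"
  by (auto simp: join_def)

lemma cut_ge: "run t (join c N (B(i := y))) \<Longrightarrow> run (cut c N i B t r) y"
  by (induction t arbitrary: r) (auto split: nat.split simp: join_upd join_upd')

lemma cut_le:
  "run (cut c N i B t r) y \<Longrightarrow>
     run t (join c N (B(i := y))) \<or> blk_queries N i t (join c N (B(i := y))) > r"
proof (induction t arbitrary: r)
  case (Query v t0 t1)
  define Z where "Z = join c N (B(i := y))"
  note IH = Query.IH[folded Z_def]
  show ?case unfolding Z_def [symmetric]
  proof (cases "v < c * N \<and> v div N = i")
    case True
    then have "Z v = y (v mod N)" by (auto simp: Z_def join_upd')
    \<comment> \<open>With \<open>r = 0\<close> the budget is spent and the present query alone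
      exceeds it; otherwise the induction hypotheses apply to \<open>r - 1\<close>.\<close>
    then show "run (Query v t0 t1) Z \<or> r < blk_queries N i (Query v t0 t1) Z"
      using Query.prems True IH(1)[of "r - 1"] IH(2)[of "r - 1"]
      by (cases r; cases "y (v mod N)") auto
  next
    case False
    then have "Z v = join c N B v" by (simp add: Z_def join_upd)
    then show "run (Query v t0 t1) Z \<or> r < blk_queries N i (Query v t0 t1) Z"
      using Query.prems False IH(1)[of r] IH(2)[of r]
      by (cases "join c N B v") auto
  qed
qed simp

text \<open>Querying all variables decides everything. This makes the set behind \<open>RQ\<close>
  nonempty, so that its \<open>LEAST\<close> is attained.\<close>

lemma ex_tree:
  assumes "\<And>x y. (\<forall>i<N. x i = y i) \<Longrightarrow> f x = f y"
  shows "\<exists>t. queried_vars t \<subseteq> {..<N} \<and> run t = f"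
  using assms
proof (induction N arbitrary: f)
  case 0
  have "run (Answer (f undefined)) x = f x" for x
    using "0"[of undefined x] by simp
  then have "run (Answer (f undefined)) = f" by (rule ext)
  then show ?case by (intro exI[of _ "Answer (f undefined)"]) simp
next
  case (Suc N)
  have "\<exists>t. queried_vars t \<subseteq> {..<N} \<and> run t = (\<lambda>x. f (x(N := b)))" for b
    by (rule Suc.IH) (auto intro!: Suc.prems simp: less_Suc_eq)
  then obtain t where t: "\<And>b. queried_vars (t b) \<subseteq> {..<N} \<and> run (t b) = (\<lambda>x. f (x(N := b)))"
    by metis
  have "run (Query N (t False) (t True)) x = f x" for x
    by (cases "x N") (auto simp: t fun_upd_idem)
  then have "queried_vars (Query N (t False) (t True)) \<subseteq> {..<Suc N} \<and>
      run (Query N (t False) (t True)) = f"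
    using t by (auto simp: less_Suc_eq subset_iff)
  then show ?case by blast
qed

lemma queries_bounded: "\<exists>d. \<forall>x. queries t x \<le> d"
proof (induction t)
  case (Query v t0 t1)
  then obtain d0 d1 where "\<forall>x. queries t0 x \<le> d0" "\<forall>x. queries t1 x \<le> d1" by blast
  then have "\<forall>x. queries (Query v t0 t1) x \<le> Suc (max d0 d1)" by (auto simp: le_max_iff_disj)
  then show ?case by blast
qed auto

subsection \<open>Indistinguishable distributions\<close>

definition pr :: "'a pmf \<Rightarrow> ('a \<Rightarrow> bool) \<Rightarrow> real" where
  "pr p Q = measure_pmf.prob p {x. Q x}"

lemma pr_eq_pmf: "pr p Q = pmf (map_pmf Q p) True"
  by (simp add: pr_def pmf_map vimage_def)

lemma pr_bounds: "0 \<le> pr p Q" "pr p Q \<le> 1"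
  by (auto simp: pr_def)

lemma pr_map [simp]: "pr (map_pmf f p) Q = pr p (\<lambda>x. Q (f x))"
  by (simp add: pr_def vimage_def)

lemma pr_bind: "pr (bind_pmf p f) Q = measure_pmf.expectation p (\<lambda>x. pr (f x) Q)"
  by (simp add: pr_eq_pmf map_bind_pmf pmf_bind)

lemma integrable_pmf_bounded:
  fixes f :: "'a \<Rightarrow> real"
  assumes "\<And>x. \<bar>f x\<bar> \<le> C"
  shows "integrable (measure_pmf p) f"
  using assms by (intro measure_pmf.integrable_const_bound[where B = C]) auto

lemma integrable_pr [simp]: "integrable (measure_pmf p) (\<lambda>x. pr (f x) (Q x))"
  by (rule integrable_pmf_bounded[of _ 1]) (simp add: pr_bounds)

lemma pr_eq_expectation: "pr p Q = measure_pmf.expectation p (\<lambda>x. of_bool (Q x))"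
proof -
  have "pr p Q = measure_pmf.expectation p (indicator {x. Q x})"
    by (simp add: pr_def)
  also have "indicator {x. Q x} = (\<lambda>x. of_bool (Q x) :: real)"
    by (auto simp: indicator_def fun_eq_iff)
  finally show ?thesis .
qed

lemma pr_mono: "(\<And>x. x \<in> set_pmf p \<Longrightarrow> Q x \<Longrightarrow> R x) \<Longrightarrow> pr p Q \<le> pr p R"
  unfolding pr_eq_expectation
  by (intro integral_mono_AE integrable_pmf_bounded[of _ 1]) (auto simp: AE_measure_pmf_iff)

lemma pr_disj: "pr p (\<lambda>x. Q x \<or> R x) \<le> pr p Q + pr p R"
proof -
  have "pr p (\<lambda>x. Q x \<or> R x) \<le>
      measure_pmf.expectation p (\<lambda>x. of_bool (Q x) + of_bool (R x))"
    unfolding pr_eq_expectation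
    by (intro integral_mono integrable_pmf_bounded[of _ 2]) auto
  also have "\<dots> = pr p Q + pr p R"
    unfolding pr_eq_expectation
    by (intro Bochner_Integration.integral_add integrable_pmf_bounded[of _ 1]) auto
  finally show ?thesis .
qed

lemma pr_not: "pr p (\<lambda>x. \<not> Q x) = 1 - pr p Q"
proof -
  have "{x. \<not> Q x} = space (measure_pmf p) - {x. Q x}" by auto
  then show ?thesis
    using measure_pmf.prob_compl[of "{x. Q x}" p] by (simp add: pr_def)
qed

lemma pr_pmf_of_set:
  assumes "finite I" "I \<noteq> {}"
  shows "pr (bind_pmf (pmf_of_set I) f) Q = (\<Sum>i\<in>I. pr (f i) Q) / card I"
  using assms by (simp add: pr_bind integral_pmf_of_set)

text \<open>The inequality is one-sided, which costs nothing because the class of trees is closed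
  under negating answers. The strict bound by a real \<open>d\<close> is what later yields
  \<open>RQ >= d\<close>.\<close>

definition indist :: "nat \<Rightarrow> real \<Rightarrow> real \<Rightarrow> (nat \<Rightarrow> bool) pmf \<Rightarrow> (nat \<Rightarrow> bool) pmf \<Rightarrow> bool" where
  "indist N d \<delta> p q \<longleftrightarrow>
     (\<forall>t. queried_vars t \<subseteq> {..<N} \<longrightarrow> (\<forall>x. real (queries t x) < d) \<longrightarrow> pr p (run t) \<le> pr q (run t) + \<delta>)"

lemma indist_sym: "indist N d \<delta> p q \<Longrightarrow> indist N d \<delta> q p"
  unfolding indist_def
proof (intro allI impI)
  fix t
  assume *: "\<forall>t. queried_vars t \<subseteq> {..<N} \<longrightarrow> (\<forall>x. real (queries t x) < d) \<longrightarrow>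
      pr p (run t) \<le> pr q (run t) + \<delta>"
    and t: "queried_vars t \<subseteq> {..<N}" "\<forall>x. real (queries t x) < d"
  have "run (neg_tree t) = (\<lambda>x. \<not> run t x)" by (simp add: fun_eq_iff)
  then show "pr q (run t) \<le> pr p (run t) + \<delta>"
    using *[rule_format, of "neg_tree t"] t by (simp add: pr_not)
qed

lemma indist_mono: "indist N d \<delta> p q \<Longrightarrow> d' \<le> d \<Longrightarrow> \<delta> \<le> \<delta>' \<Longrightarrow> indist N d' \<delta>' p q"
  unfolding indist_def by (smt (verit))

text \<open>The form in which lower bounds travel through the induction: a pair of distributions
  against deterministic trees, as in the easy direction of Yao's principle.\<close>

definition hard :: "nat \<Rightarrow> ((nat \<Rightarrow> bool) \<Rightarrow> bool) \<Rightarrow> real \<Rightarrow> real \<Rightarrow> bool" where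
  "hard N f d \<delta> \<longleftrightarrow> (\<exists>p q. (\<forall>x\<in>set_pmf p. f x) \<and> (\<forall>x\<in>set_pmf q. \<not> f x) \<and> indist N d \<delta> p q)"

lemma hard_mono: "hard N f d \<delta> \<Longrightarrow> d' \<le> d \<Longrightarrow> \<delta> \<le> \<delta>' \<Longrightarrow> hard N f d' \<delta>'"
  unfolding hard_def using indist_mono by blast

definition blocks :: "nat \<Rightarrow> (nat \<Rightarrow> (nat \<Rightarrow> bool) pmf) \<Rightarrow> (nat \<Rightarrow> nat \<Rightarrow> bool) pmf" where
  "blocks c p = Pi_pmf {..<c} (\<lambda>_. False) p"

text \<open>Independence allows block \<open>i\<close> to be drawn last. With the other blocks
  fixed, a tree on all blocks becomes a tree on block \<open>i\<close>.\<close>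

lemma blocks_upd:
  assumes "i < c"
  shows "blocks c (p(i := q)) =
    bind_pmf (Pi_pmf ({..<c} - {i}) (\<lambda>_. False) p) (\<lambda>B. map_pmf (\<lambda>y. B(i := y)) q)"
proof -
  have "blocks c (p(i := q)) = Pi_pmf (insert i ({..<c} - {i})) (\<lambda>_. False) (p(i := q))"
    using assms by (simp add: blocks_def insert_absorb)
  also have "\<dots> = bind_pmf q (\<lambda>y. bind_pmf (Pi_pmf ({..<c} - {i}) (\<lambda>_. False) (p(i := q)))
      (\<lambda>B. return_pmf (B(i := y))))"
    by (subst Pi_pmf_insert') auto
  also have "Pi_pmf ({..<c} - {i}) (\<lambda>_. False) (p(i := q)) = Pi_pmf ({..<c} - {i}) (\<lambda>_. False) p"
    by (intro Pi_pmf_cong) auto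
  finally show ?thesis
    unfolding map_pmf_def bind_commute_pmf[of q] .
qed

lemma set_blocks: "B \<in> set_pmf (blocks c p) \<Longrightarrow> i < c \<Longrightarrow> B i \<in> set_pmf (p i)"
  using set_Pi_pmf_subset'[of "{..<c}" "\<lambda>_. False" p] by (auto simp: blocks_def PiE_dflt_def)

text \<open>\<open>cut\<close> turns \<open>t\<close> into a tree on block \<open>i\<close> to which
  \<open>indist\<close> applies. Truncation only adds acceptances, so it is free on the side of
  \<open>q\<close> and charged on the side of \<open>q'\<close> alone: the long runs are counted
  under one distribution, the same for all \<open>i\<close> in the NAND argument.\<close>

lemma block_step:
  assumes i: "i < c" and d: "d > 0" and ind: "indist N d \<delta> q q'"
  shows "pr (blocks c (p(i := q))) (\<lambda>B. run t (join c N B))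
     \<le> pr (blocks c (p(i := q'))) (\<lambda>B. run t (join c N B)) + \<delta>
        + pr (blocks c (p(i := q'))) (\<lambda>B. real (blk_queries N i t (join c N B)) \<ge> d)"
proof -
  \<comment> \<open>The largest integer below \<open>d\<close>: a tree cut at \<open>r\<close> stays
    below \<open>d\<close> queries, and exceeding \<open>r\<close> means at least \<open>d\<close>
    queries.\<close>
  define r where "r = nat (\<lceil>d\<rceil> - 1)"
  have r: "real r < d" "\<And>k. k > r \<Longrightarrow> real k \<ge> d"
    using d unfolding r_def by linarith+
  define R where "R = Pi_pmf ({..<c} - {i}) (\<lambda>_. False) p"
  have "pr q (\<lambda>y. run t (join c N (B(i := y)))) \<le> pr q' (\<lambda>y. run t (join c N (B(i := y)))) + \<delta>
       + pr q' (\<lambda>y. real (blk_queries N i t (join c N (B(i := y)))) \<ge> d)" for B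
  proof -
    have "pr q (\<lambda>y. run t (join c N (B(i := y)))) \<le> pr q (run (cut c N i B t r))"
      by (intro pr_mono cut_ge)
    also have "\<dots> \<le> pr q' (run (cut c N i B t r)) + \<delta>"
      using ind queried_vars_cut queries_cut r(1) unfolding indist_def
      by (meson le_less_trans of_nat_mono)
    also have "pr q' (run (cut c N i B t r)) \<le> pr q' (\<lambda>y. run t (join c N (B(i := y))) \<or>
        real (blk_queries N i t (join c N (B(i := y)))) \<ge> d)"
      by (intro pr_mono) (use cut_le r(2) in blast)
    also note pr_disj
    finally show ?thesis by (simp add: algebra_simps)
  qed
  then have "measure_pmf.expectation R (\<lambda>B. pr q (\<lambda>y. run t (join c N (B(i := y))))) \<le>
     measure_pmf.expectation R (\<lambda>B. pr q' (\<lambda>y. run t (join c N (B(i := y)))) + \<delta>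
       + pr q' (\<lambda>y. real (blk_queries N i t (join c N (B(i := y)))) \<ge> d))"
    by (intro integral_mono) auto
  then show ?thesis
    using i by (simp add: blocks_upd pr_bind R_def)
qed

subsection \<open>Hardness of NAND composition and of cheat sheets\<close>

text \<open>Functions live on all sequences, not on \<open>cube N\<close>, until the very end;
  blocks can then be composed without restrictions.\<close>

definition depends_on :: "nat \<Rightarrow> ((nat \<Rightarrow> bool) \<Rightarrow> 'a) \<Rightarrow> bool" where
  "depends_on N f \<longleftrightarrow> (\<forall>x y. (\<forall>i<N. x i = y i) \<longrightarrow> f x = f y)"

lemma depends_onD: "depends_on N f \<Longrightarrow> (\<And>i. i < N \<Longrightarrow> x i = y i) \<Longrightarrow> f x = f y"
  by (auto simp: depends_on_def)

lemma block_index: "i < c \<Longrightarrow> j < N \<Longrightarrow> i * N + j < c * (N::nat)"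
proof -
  assume "i < c" "j < N"
  then have "i * N + j < Suc i * N" by simp
  also have "\<dots> \<le> c * N" using \<open>i < c\<close> by (intro mult_le_mono1) simp
  finally show ?thesis .
qed

lemma blk_join: "i < c \<Longrightarrow> j < N \<Longrightarrow> blk N i (join c N B) j = B i j"
  using block_index[of i c j N] by (auto simp: blk_def join_def)

section \<open>NAND composition\<close>

definition nand :: "nat \<Rightarrow> nat \<Rightarrow> ((nat \<Rightarrow> bool) \<Rightarrow> bool) \<Rightarrow> (nat \<Rightarrow> bool) \<Rightarrow> bool" where
  "nand n N g x \<longleftrightarrow> (\<exists>i<n. \<not> g (blk N i x))"

lemma depends_on_blk:
  assumes "depends_on N g" "i < n" "\<And>v. v < n * N \<Longrightarrow> x v = y v"
  shows "g (blk N i x) = g (blk N i y)"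
  using assms block_index[of i n] by (intro depends_onD[OF assms(1)]) (auto simp: blk_def)

lemma depends_on_nand:
  assumes "depends_on N g"
  shows "depends_on (n * N) (nand n N g)"
  unfolding depends_on_def
proof (intro allI impI)
  fix x y :: "nat \<Rightarrow> bool"
  assume xy: "\<forall>i<n * N. x i = y i"
  have "g (blk N i x) = g (blk N i y)" if "i < n" for i
    using that xy by (intro depends_on_blk[OF assms]) auto
  then show "nand n N g x = nand n N g y"
    by (auto simp: nand_def)
qed

text \<open>Every planted position \<open>i\<close> is compared with the same distribution
  \<open>Y\<close>, which has no planted block. The events that block \<open>i\<close> receives at
  least \<open>d\<close> queries are thus all measured under \<open>Y\<close>, where the total
  number of queries bounds how many of them occur; averaging over \<open>i\<close> leaves an error
  of \<open>\<epsilon>\<close>.\<close>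

lemma hard_nand:
  assumes hard: "hard N g d \<delta>" and n: "n > 0" and d: "d > 0" and dep: "depends_on N g"
  shows "hard (n * N) (nand n N g) (n * \<epsilon> * d) (\<delta> + \<epsilon>)"
proof -
  obtain p q where pq: "\<forall>x\<in>set_pmf p. g x" "\<forall>x\<in>set_pmf q. \<not> g x" "indist N d \<delta> p q"
    using hard unfolding hard_def by blast
  define X where "X = (\<lambda>i. blocks n ((\<lambda>_. p)(i := q)))"
  define Y where "Y = blocks n (\<lambda>_. p)"
  let ?\<nu>1 = "map_pmf (join n N) (bind_pmf (pmf_of_set {..<n}) X)"
  let ?\<nu>0 = "map_pmf (join n N) Y"
  have g: "g (blk N i (join n N B)) = g (B i)" if "i < n" for i B
    using that by (intro depends_onD[OF dep] blk_join)
  have ne: "{..<n} \<noteq> {}" using n by auto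
  have 1: "nand n N g x" if x: "x \<in> set_pmf ?\<nu>1" for x
  proof -
    obtain i B where i: "i < n" "B \<in> set_pmf (X i)" "x = join n N B"
      using x ne by (auto simp: set_pmf_of_set)
    then have "B i \<in> set_pmf q"
      using set_blocks[of B n "(\<lambda>_. p)(i := q)" i] by (simp add: X_def)
    with i pq g show ?thesis by (auto simp: nand_def)
  qed
  have 2: "\<not> nand n N g x" if x: "x \<in> set_pmf ?\<nu>0" for x
    using x pq g set_blocks[of _ n "\<lambda>_. p"] by (auto simp: nand_def Y_def)
  have 3: "indist (n * N) (n * \<epsilon> * d) (\<delta> + \<epsilon>) ?\<nu>1 ?\<nu>0"
    unfolding indist_def
  proof (intro allI impI)
    fix t assume t: "\<forall>x. real (queries t x) < n * \<epsilon> * d"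
    let ?R = "\<lambda>B. run t (join n N B)"
    let ?Q = "\<lambda>i B. real (blk_queries N i t (join n N B)) \<ge> d"
    have "pr (X i) ?R \<le> pr Y ?R + \<delta> + pr Y (?Q i)" if "i < n" for i
      using block_step[OF that d indist_sym[OF pq(3)], of "\<lambda>_. p" t]
      by (simp add: X_def Y_def fun_upd_idem)
    then have "(\<Sum>i<n. pr (X i) ?R) \<le> (\<Sum>i<n. pr Y ?R + \<delta> + pr Y (?Q i))"
      by (intro sum_mono) auto
    also have "\<dots> = n * (pr Y ?R + \<delta>) + (\<Sum>i<n. pr Y (?Q i))"
      by (simp add: sum.distrib algebra_simps)
    also have "(\<Sum>i<n. pr Y (?Q i)) = measure_pmf.expectation Y (\<lambda>B. \<Sum>i<n. of_bool (?Q i B))"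
      unfolding pr_eq_expectation
      by (subst Bochner_Integration.integral_sum) (auto intro!: integrable_pmf_bounded[of _ 1])
    also have "\<dots> \<le> measure_pmf.expectation Y (\<lambda>B. n * \<epsilon>)"
    proof (intro integral_mono integrable_pmf_bounded)
      fix B
      \<comment> \<open>Markov's inequality in counting form: each block with \<open>?Q\<close> uses
        at least \<open>d\<close> of fewer than \<open>n * \<epsilon> * d\<close> queries.\<close>
      have "(\<Sum>i<n. of_bool (?Q i B)) * d \<le> (\<Sum>i<n. real (blk_queries N i t (join n N B)))"
        unfolding sum_distrib_right by (intro sum_mono) auto
      also have "\<dots> \<le> real (queries t (join n N B))"
        using sum_blk_queries[of N t "join n N B" n] by (simp flip: of_nat_sum)
      also have "\<dots> \<le> n * \<epsilon> * d" using t by (meson less_imp_le)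
      finally show "(\<Sum>i<n. of_bool (?Q i B)) \<le> n * \<epsilon>" using d by simp
    next
      fix B
      have "(\<Sum>i<n. of_bool (?Q i B)) \<le> (\<Sum>i<n. 1::real)" by (intro sum_mono) auto
      then show "\<bar>\<Sum>i<n. of_bool (?Q i B) :: real\<bar> \<le> n" by (simp add: sum_nonneg abs_of_nonneg)
    qed auto
    also have "\<dots> = n * \<epsilon>" by simp
    finally have "(\<Sum>i<n. pr (X i) ?R) / n \<le> pr Y ?R + \<delta> + \<epsilon>"
      using n by (simp add: field_simps)
    then show "pr ?\<nu>1 (run t) \<le> pr ?\<nu>0 (run t) + (\<delta> + \<epsilon>)"
      using ne by (simp add: pr_pmf_of_set add.assoc)
  qed
  show ?thesis
    unfolding hard_def by (intro exI[of _ ?\<nu>1] exI[of _ ?\<nu>0] conjI ballI 1 2 3)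
qed

text \<open>The label is the number of the cheat sheet that has to be filled in.\<close>

definition label :: "nat \<Rightarrow> nat \<Rightarrow> ((nat \<Rightarrow> bool) \<Rightarrow> bool) \<Rightarrow> (nat \<Rightarrow> bool) \<Rightarrow> nat" where
  "label c N g z = horner_sum of_bool 2 (map (\<lambda>i. g (blk N i z)) [0..<c])"

lemma label_less: "label c N g z < 2 ^ c"
  using horner_sum_of_bool_2_less[of "map (\<lambda>i. g (blk N i z)) [0..<c]", where 'a = nat]
  by (simp add: label_def)

lemma bit_label: "bit (label c N g z) i \<longleftrightarrow> i < c \<and> g (blk N i z)"
  by (auto simp: label_def bit_horner_sum_bit_iff)

lemma label_eq_iff: "label c N g z = label c N g z' \<longleftrightarrow> (\<forall>i<c. g (blk N i z) = g (blk N i z'))"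
  by (auto simp: bit_eq_iff bit_label)

lemma depends_on_label:
  assumes "depends_on N g"
  shows "depends_on (c * N) (label c N g)"
  unfolding depends_on_def[of "c * N"] label_eq_iff
  using depends_on_blk[OF assms, of _ c] by blast

lemma label_eqI:
  assumes "l < 2 ^ c" "\<And>i. i < c \<Longrightarrow> g (blk N i z) = bit l i"
  shows "label c N g z = l"
proof -
  have "take_bit c l = l" using assms(1) by (simp add: take_bit_nat_eq_self)
  then have "\<not> bit l i" if "i \<ge> c" for i
    using that by (metis bit_take_bit_iff leD)
  then show ?thesis using assms(2) by (auto simp: bit_eq_iff bit_label) (metis not_le)+
qed

text \<open>A cheat sheet consists of \<open>m\<close> bits which encode a set of input positions. A sheet is
  accepted when the input bits at these positions certify the label that selects this very sheet.\<close>

definition decoder :: "nat \<Rightarrow> nat \<Rightarrow> nat \<Rightarrow> ((nat \<Rightarrow> bool) \<Rightarrow> nat set option) \<Rightarrow> bool" where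
  "decoder M w m dec \<longleftrightarrow> depends_on m dec \<and> dec (\<lambda>_. False) = None \<and>
     (\<forall>s S. dec s = Some S \<longrightarrow> S \<subseteq> {..<M} \<and> card S \<le> w) \<and>
     (\<forall>S. S \<subseteq> {..<M} \<longrightarrow> card S \<le> w \<longrightarrow> (\<exists>s. dec s = Some S))"

definition cheat :: "nat \<Rightarrow> nat \<Rightarrow> nat \<Rightarrow> ((nat \<Rightarrow> bool) \<Rightarrow> nat set option) \<Rightarrow>
    ((nat \<Rightarrow> bool) \<Rightarrow> bool) \<Rightarrow> (nat \<Rightarrow> bool) \<Rightarrow> bool" where
  "cheat c N m dec g z \<longleftrightarrow>
     (case dec (\<lambda>t. z (c * N + label c N g z * m + t)) of None \<Rightarrow> False
      | Some S \<Rightarrow> \<forall>y. (\<forall>v\<in>S. z v = y v) \<longrightarrow> label c N g y = label c N g z)"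

definition sheet :: "nat \<Rightarrow> nat \<Rightarrow> nat \<Rightarrow> nat \<Rightarrow> nat set" where
  "sheet c N m l = {v. \<exists>t<m. v = c * N + l * m + t}"

section \<open>Hardness of cheat sheets\<close>

lemma disjoint_sheet: "disjoint_family (sheet c N m)"
proof -
  have "l = l'" if "l * m + t = l' * m + t'" "t < m" "t' < m" for l l' t t'
  proof -
    have "(l * m + t) div m = l" "(l' * m + t') div m = l'" using that(2,3) by auto
    then show ?thesis using that(1) by metis
  qed
  then show ?thesis
    unfolding disjoint_family_on_def sheet_def by (auto simp: add.assoc)
qed

text \<open>The blocks are exchanged one at a time, each at cost \<open>\<delta>\<close>. The
  overflow term of \<open>block_step\<close> vanishes, since even the whole tree makes fewer than
  \<open>d\<close> queries.\<close>

lemma hybrid: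
  assumes ind: "indist N d \<delta> p q" and d: "d > 0" and \<delta>: "\<delta> \<ge> 0"
    and t: "\<And>x. real (queries t x) < d"
  shows "pr (blocks c (\<lambda>i. if b i then p else q)) (\<lambda>B. run t (join c N B))
     \<le> pr (blocks c (\<lambda>i. if b' i then p else q)) (\<lambda>B. run t (join c N B)) + c * \<delta>"
proof -
  \<comment> \<open>The hybrids: \<open>b\<close> governs the first \<open>j\<close> blocks and
    \<open>b'\<close> the others.\<close>
  define X where "X = (\<lambda>j i. if (if i < j then b i else b' i) then p else q)"
  let ?R = "\<lambda>B. run t (join c N B)"
  have refl: "indist N d \<delta> r r" for r
    using \<delta> by (simp add: indist_def)
  have "j \<le> c \<Longrightarrow> pr (blocks c (X j)) ?R \<le> pr (blocks c (X 0)) ?R + j * \<delta>" for j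
  proof (induction j)
    case (Suc j)
    define r r' where "r = (if b j then p else q)" and "r' = (if b' j then p else q)"
    have X: "X (Suc j) = (X j)(j := r)" "X j = (X j)(j := r')"
      by (auto simp: X_def r_def r'_def fun_eq_iff less_Suc_eq)
    have "indist N d \<delta> r r'"
      using ind indist_sym[OF ind] refl by (simp add: r_def r'_def)
    then have "pr (blocks c (X (Suc j))) ?R \<le> pr (blocks c (X j)) ?R + \<delta>
      + pr (blocks c (X j)) (\<lambda>B. real (blk_queries N j t (join c N B)) \<ge> d)"
      using block_step[of j c d N \<delta> r r' "X j" t] Suc.prems d X by simp
    also have "real (blk_queries N j t x) < d" for x
      using t[of x] blk_queries_le[of N j t x] by linarith
    then have "pr (blocks c (X j)) (\<lambda>B. real (blk_queries N j t (join c N B)) \<ge> d) = 0"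
      by (simp add: pr_def not_le [symmetric])
    finally show ?case using Suc by (simp add: algebra_simps)
  qed simp
  from this[of c] have "pr (blocks c (X c)) ?R \<le> pr (blocks c (X 0)) ?R + c * \<delta>" by simp
  also have "blocks c (X c) = blocks c (\<lambda>i. if b i then p else q)"
    unfolding blocks_def by (intro Pi_pmf_cong) (auto simp: X_def)
  finally show ?thesis by (simp add: X_def)
qed

text \<open>Blank sheets give value 0, and writing a valid certificate into the selected sheet gives
  value 1, so only touching that sheet can help. Were the copies independent of the label, a uniform
  label would be hit with probability at most \<open>d / 2 ^ c\<close>; the dependence costs
  \<open>c * \<delta>\<close> by \<open>hybrid\<close>.\<close>

lemma hard_cheat:
  assumes hard: "hard N g d \<delta>" and d: "d > 0" and \<delta>: "\<delta> \<ge> 0" and dep: "depends_on N g"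
    and dec: "decoder (c * N) w m dec"
    and cert: "\<And>x. \<exists>S\<subseteq>{..<c * N}. card S \<le> w \<and>
      (\<forall>y. (\<forall>v\<in>S. x v = y v) \<longrightarrow> label c N g y = label c N g x)"
  shows "hard (c * N + 2 ^ c * m) (cheat c N m dec g) d (c * \<delta> + d / 2 ^ c)"
proof -
  obtain p q where pq: "\<forall>x\<in>set_pmf p. g x" "\<forall>x\<in>set_pmf q. \<not> g x" "indist N d \<delta> p q"
    using hard unfolding hard_def by blast
  \<comment> \<open>The bits of \<open>l\<close> prescribe the values of the copies, so
    \<open>X l\<close> has label \<open>l\<close> and the label under \<open>Y\<close> is
    uniform.\<close>
  define X where "X = (\<lambda>l::nat. blocks c (\<lambda>i. if bit l i then p else q))"
  define Y where "Y = bind_pmf (pmf_of_set {..<2 ^ c}) X"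
  have "\<exists>S s. S \<subseteq> {..<c * N} \<and> dec s = Some S \<and>
      (\<forall>y. (\<forall>v\<in>S. x v = y v) \<longrightarrow> label c N g y = label c N g x)" for x
    using cert[of x] dec unfolding decoder_def by meson
  then obtain S s where S: "\<And>x. S x \<subseteq> {..<c * N}" "\<And>x. dec (s x) = Some (S x)"
      "\<And>x y. (\<forall>v\<in>S x. x v = y v) \<Longrightarrow> label c N g y = label c N g x"
    by metis
  define lab where "lab = (\<lambda>B. label c N g (join c N B))"
  define fill where "fill = (\<lambda>B v. if v \<in> sheet c N m (lab B)
     then s (join c N B) (v - (c * N + lab B * m)) else join c N B v)"
  have fill_join: "fill B v = join c N B v" if "v < c * N" for B v
    using that by (auto simp: fill_def sheet_def)
  have lab_fill: "label c N g (fill B) = lab B" for B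
    unfolding lab_def by (intro depends_onD[OF depends_on_label[OF dep]] fill_join)
  have cheat1: "cheat c N m dec g (fill B)" for B
  proof -
    have "dec (\<lambda>t. fill B (c * N + lab B * m + t)) = dec (s (join c N B))"
      using dec by (intro depends_onD[of m dec]) (auto simp: decoder_def fill_def sheet_def)
    moreover have "label c N g y = lab B" if "\<forall>v\<in>S (join c N B). fill B v = y v" for y
      unfolding lab_def using that S(1) fill_join by (intro S(3)) (metis lessThan_iff subsetD)
    ultimately show ?thesis by (simp add: cheat_def lab_fill S(2))
  qed
  have cheat0: "\<not> cheat c N m dec g (join c N B)" for B
  proof -
    have "(\<lambda>t. join c N B (c * N + label c N g (join c N B) * m + t)) = (\<lambda>_. False)"
      by (auto simp: join_def)
    then show ?thesis using dec by (simp add: cheat_def decoder_def)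
  qed
  have "0 \<in> {..<2 ^ c :: nat}" by simp
  then have ne: "{..<2 ^ c :: nat} \<noteq> {}" by blast
  have lab_X: "lab B = l" if "l < 2 ^ c" "B \<in> set_pmf (X l)" for l B
    unfolding lab_def
  proof (rule label_eqI[OF that(1)])
    fix i assume i: "i < c"
    have "g (blk N i (join c N B)) = g (B i)"
      using i by (intro depends_onD[OF dep] blk_join)
    then show "g (blk N i (join c N B)) = bit l i"
      using set_blocks[OF that(2)[unfolded X_def] i] pq by (auto split: if_splits)
  qed
  have ind: "indist (c * N + 2 ^ c * m) d (c * \<delta> + d / 2 ^ c) (map_pmf fill Y) (map_pmf (join c N) Y)"
    unfolding indist_def
  proof (intro allI impI)
    fix t assume t: "\<forall>x. real (queries t x) < d"
    define T where "T = (\<lambda>l B. run (touch (sheet c N m l) t) (join c N B))"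
    have queries_T: "real (queries (touch (sheet c N m l) t) x) < d" for l x
      using t queries_touch[of "sheet c N m l" t x] by (meson le_less_trans of_nat_mono)
    \<comment> \<open>The filled and the blank input differ only on the selected sheet, so
      \<open>run_touch\<close> applies.\<close>
    have "pr Y (\<lambda>B. run t (fill B)) \<le> pr Y (\<lambda>B. run t (join c N B) \<or> T (lab B) B)"
    proof (rule pr_mono)
      fix B assume "run t (fill B)"
      then show "run t (join c N B) \<or> T (lab B) B"
        unfolding T_def by (rule run_touch) (simp add: fill_def)
    qed
    also have "\<dots> \<le> pr Y (\<lambda>B. run t (join c N B)) + pr Y (\<lambda>B. T (lab B) B)"
      by (rule pr_disj)
    also have "pr Y (\<lambda>B. T (lab B) B) = (\<Sum>l<2 ^ c. pr (X l) (\<lambda>B. T (lab B) B)) / 2 ^ c"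
      unfolding Y_def by (subst pr_pmf_of_set) (use ne in auto)
    \<comment> \<open>On the support of \<open>X l\<close> the label is \<open>l\<close>, which
      replaces the sheet depending on \<open>B\<close> by a fixed one.\<close>
    also have "(\<Sum>l<2 ^ c. pr (X l) (\<lambda>B. T (lab B) B)) \<le> (\<Sum>l<2 ^ c. pr (X l) (T l))"
      by (intro sum_mono pr_mono) (use lab_X in auto)
    \<comment> \<open>All labels are moved to the one distribution \<open>X 0\<close>. The sheets
      then compete for the queries of \<open>t\<close> on a common input, where
      \<open>sum_touch_le\<close> applies.\<close>
    also have "\<dots> \<le> (\<Sum>l<2 ^ c. pr (X 0) (T l) + c * \<delta>)"
      unfolding X_def T_def by (intro sum_mono hybrid[OF pq(3) d \<delta> queries_T])
    also have "\<dots> = (\<Sum>l<2 ^ c. pr (X 0) (T l)) + 2 ^ c * (c * \<delta>)"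
      by (simp add: sum.distrib)
    also have "(\<Sum>l<2 ^ c. pr (X 0) (T l)) =
        measure_pmf.expectation (X 0) (\<lambda>B. \<Sum>l<2 ^ c. of_bool (T l B))"
      unfolding pr_eq_expectation
      by (subst Bochner_Integration.integral_sum) (auto intro!: integrable_pmf_bounded[of _ 1])
    also have "\<dots> \<le> measure_pmf.expectation (X 0) (\<lambda>B. d)"
    proof (intro integral_mono integrable_pmf_bounded)
      fix B
      have *: "(\<Sum>l<2 ^ c. of_bool (T l B)) \<le> queries t (join c N B)"
        unfolding T_def using disjoint_sheet
        by (intro sum_touch_le) (auto simp: disjoint_family_on_def)
      have "(\<Sum>l<2 ^ c. of_bool (T l B) :: real) = real (\<Sum>l<2 ^ c. of_bool (T l B))"
        by simp
      also have "\<dots> \<le> d" using * t by (meson le_less_trans less_imp_le of_nat_mono)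
      finally show "(\<Sum>l<2 ^ c. of_bool (T l B) :: real) \<le> d" .
      then show "\<bar>\<Sum>l<2 ^ c. of_bool (T l B) :: real\<bar> \<le> d" by (simp add: sum_nonneg abs_of_nonneg)
    qed auto
    finally show "pr (map_pmf fill Y) (run t) \<le>
        pr (map_pmf (join c N) Y) (run t) + (c * \<delta> + d / 2 ^ c)"
      by (simp add: divide_simps) (simp add: algebra_simps)?
  qed
  show ?thesis
    unfolding hard_def
    by (rule exI[of _ "map_pmf fill Y"], rule exI[of _ "map_pmf (join c N) Y"])
       (use ind cheat0 cheat1 in auto)
qed

subsection \<open>Certificates as set-valued functions\<close>

text \<open>A certificate is represented by its set of positions; the values are read off from
  \<open>x\<close>. Nothing is asked of \<open>S x\<close> when \<open>g x\<close> differs from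
  \<open>b\<close>.\<close>

definition certifies ::
    "nat \<Rightarrow> ((nat \<Rightarrow> bool) \<Rightarrow> bool) \<Rightarrow> bool \<Rightarrow> nat \<Rightarrow> ((nat \<Rightarrow> bool) \<Rightarrow> nat set) \<Rightarrow> bool" where
  "certifies N g b w S \<longleftrightarrow> (\<forall>x. g x = b \<longrightarrow> S x \<subseteq> {..<N} \<and> card (S x) \<le> w \<and>
     (\<forall>y. (\<forall>v\<in>S x. x v = y v) \<longrightarrow> g y = b))"

text \<open>If \<open>y\<close> extends the certificate of \<open>x\<close>, then equal position
  sets make the certificate of \<open>y\<close> the same partial assignment. Hence no input is
  consistent with two different certificates.\<close>

definition unambiguous ::
    "((nat \<Rightarrow> bool) \<Rightarrow> bool) \<Rightarrow> bool \<Rightarrow> ((nat \<Rightarrow> bool) \<Rightarrow> nat set) \<Rightarrow> bool" where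
  "unambiguous g b S \<longleftrightarrow> (\<forall>x y. g x = b \<longrightarrow> (\<forall>v\<in>S x. x v = y v) \<longrightarrow> S y = S x)"

definition cert :: "nat \<Rightarrow> ((nat \<Rightarrow> bool) \<Rightarrow> bool) \<Rightarrow> bool \<Rightarrow> nat \<Rightarrow> bool" where
  "cert N g b w \<longleftrightarrow> (\<exists>S. certifies N g b w S)"

definition ucert :: "nat \<Rightarrow> ((nat \<Rightarrow> bool) \<Rightarrow> bool) \<Rightarrow> bool \<Rightarrow> nat \<Rightarrow> bool" where
  "ucert N g b w \<longleftrightarrow> (\<exists>S. certifies N g b w S \<and> unambiguous g b S)"

lemma certifiesD:
  assumes "certifies N g b w S" "g x = b"
  shows "S x \<subseteq> {..<N}" "card (S x) \<le> w" "\<And>y. (\<And>v. v \<in> S x \<Longrightarrow> x v = y v) \<Longrightarrow> g y = b"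
  using assms unfolding certifies_def by blast+

lemma unambiguousD:
  "unambiguous g b S \<Longrightarrow> g x = b \<Longrightarrow> (\<And>v. v \<in> S x \<Longrightarrow> x v = y v) \<Longrightarrow> S y = S x"
  unfolding unambiguous_def by blast

lemma certifiesI:
  assumes "\<And>x. g x = b \<Longrightarrow> S x \<subseteq> {..<N}" "\<And>x. g x = b \<Longrightarrow> card (S x) \<le> w"
    "\<And>x y. g x = b \<Longrightarrow> (\<And>v. v \<in> S x \<Longrightarrow> x v = y v) \<Longrightarrow> g y = b"
  shows "certifies N g b w S"
  using assms unfolding certifies_def by blast

lemma unambiguousI:
  "(\<And>x y. g x = b \<Longrightarrow> (\<And>v. v \<in> S x \<Longrightarrow> x v = y v) \<Longrightarrow> S y = S x) \<Longrightarrow> unambiguous g b S"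
  unfolding unambiguous_def by blast

lemma cert_of_ucert: "ucert N g b w \<Longrightarrow> cert N g b w"
  unfolding cert_def ucert_def by (elim exE conjE) (rule exI)

lemma certI: "certifies N g b w S \<Longrightarrow> cert N g b w"
  unfolding cert_def by (rule exI)

lemma ucertI: "certifies N g b w S \<Longrightarrow> unambiguous g b S \<Longrightarrow> ucert N g b w"
  unfolding ucert_def by (intro exI conjI)

lemma certE:
  assumes "cert N g b w"
  obtains S where "certifies N g b w S"
  using assms unfolding cert_def by (elim exE)

lemma ucertE:
  assumes "ucert N g b w"
  obtains S where "certifies N g b w S" "unambiguous g b S"
  using assms unfolding ucert_def by (elim exE conjE)

lemma certifies_mono: "certifies N g b w S \<Longrightarrow> w \<le> w' \<Longrightarrow> certifies N g b w' S"
  by (auto simp: certifies_def intro: le_trans)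

lemma ucert_mono:
  assumes "ucert N g b w" "w \<le> w'"
  shows "ucert N g b w'"
proof -
  from assms(1) obtain S where S: "certifies N g b w S" "unambiguous g b S" by (rule ucertE)
  from certifies_mono[OF S(1) assms(2)] S(2) show ?thesis by (rule ucertI)
qed

lemma depends_on_of_cert:
  assumes "cert N g True w" "cert N g False w'"
  shows "depends_on N g"
  unfolding depends_on_def
proof (intro allI impI)
  fix x y :: "nat \<Rightarrow> bool"
  assume xy: "\<forall>i<N. x i = y i"
  obtain S where S1: "certifies N g True w S" using assms(1) by (rule certE)
  obtain S' where S0: "certifies N g False w' S'" using assms(2) by (rule certE)
  show "g x = g y"
  proof (cases "g x")
    case True
    then show ?thesis using certifiesD[OF S1, of x] xy by (metis lessThan_iff subsetD)
  next
    case False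
    then show ?thesis using certifiesD[OF S0, of x] xy by (metis lessThan_iff subsetD)
  qed
qed

section \<open>Certificates of NAND compositions\<close>

definition shift :: "nat \<Rightarrow> nat \<Rightarrow> nat set \<Rightarrow> nat set" where
  "shift N i S = (\<lambda>j. i * N + j) ` S"

lemma shift_agree: "v \<in> S \<Longrightarrow> (\<And>u. u \<in> shift N i S \<Longrightarrow> x u = y u) \<Longrightarrow> blk N i x v = blk N i y v"
  by (auto simp: shift_def blk_def)

lemma card_shift [simp]: "card (shift N i S) = card S"
  unfolding shift_def by (rule card_image) (auto simp: inj_on_def)

lemma shift_subset: "S \<subseteq> {..<N} \<Longrightarrow> i < n \<Longrightarrow> shift N i S \<subseteq> {..<n * N}"
  using block_index[of i n] by (auto simp: shift_def)

lemma card_UN_shift: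
  assumes "\<And>i. i < n \<Longrightarrow> card (S i) \<le> w"
  shows "card (\<Union>i<n. shift N i (S i)) \<le> n * w"
proof -
  have "card (\<Union>i<n. shift N i (S i)) \<le> (\<Sum>i<n. card (shift N i (S i)))"
    by (rule card_UN_le) simp
  also have "\<dots> \<le> (\<Sum>i<n. w)" using assms by (intro sum_mono) auto
  finally show ?thesis by simp
qed

text \<open>On a 0-input all blocks have \<open>g = 1\<close>, and certifying each of them costs the
  factor \<open>n\<close>. Unambiguity is inherited block by block.\<close>

lemma nand_False:
  fixes n :: nat
  assumes S: "certifies N g True w S"
  defines "S' \<equiv> \<lambda>x. \<Union>i<n. shift N i (S (blk N i x))"
  shows "certifies (n * N) (nand n N g) False (n * w) S'"
    and "unambiguous g True S \<Longrightarrow> unambiguous (nand n N g) False S'"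
proof -
  have g: "g (blk N i x)" if "nand n N g x = False" "i < n" for x i
    using that by (auto simp: nand_def)
  have agree: "blk N i x v = blk N i y v"
    if "i < n" "v \<in> S (blk N i x)" "\<And>v. v \<in> S' x \<Longrightarrow> x v = y v" for x y i v
    by (rule shift_agree[OF that(2)], rule that(3)) (use that(1) in \<open>auto simp: S'_def\<close>)
  show "certifies (n * N) (nand n N g) False (n * w) S'"
  proof (rule certifiesI)
    fix x assume x: "nand n N g x = False"
    have "S (blk N i x) \<subseteq> {..<N}" "card (S (blk N i x)) \<le> w" if "i < n" for i
      using certifiesD[OF S] g[OF x that] by auto
    then show "S' x \<subseteq> {..<n * N}" "card (S' x) \<le> n * w"
      unfolding S'_def using shift_subset by (blast, intro card_UN_shift)
  next
    fix x y assume x: "nand n N g x = False" and xy: "\<And>v. v \<in> S' x \<Longrightarrow> x v = y v"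
    have "g (blk N i y)" if "i < n" for i
      using certifiesD(3)[OF S, of "blk N i x" "blk N i y"] g[OF x that] agree[OF that _ xy] by simp
    then show "nand n N g y = False" by (auto simp: nand_def)
  qed
  assume un: "unambiguous g True S"
  show "unambiguous (nand n N g) False S'"
  proof (rule unambiguousI)
    fix x y assume x: "nand n N g x = False" and xy: "\<And>v. v \<in> S' x \<Longrightarrow> x v = y v"
    have "S (blk N i y) = S (blk N i x)" if "i < n" for i
      using unambiguousD[OF un, of "blk N i x" "blk N i y"] g[OF x that] agree[OF that _ xy] by simp
    then show "S' y = S' x" by (simp add: S'_def)
  qed
qed

lemma cert_nand_False:
  assumes "cert N g True w"
  shows "cert (n * N) (nand n N g) False (n * w)"
proof -
  from assms obtain S where "certifies N g True w S" by (rule certE)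
  from nand_False(1)[OF this] show ?thesis by (rule certI)
qed

lemma ucert_nand_False:
  assumes "ucert N g True w"
  shows "ucert (n * N) (nand n N g) False (n * w)"
proof -
  from assms obtain S where S: "certifies N g True w S" "unambiguous g True S" by (rule ucertE)
  from nand_False[OF S(1)] S(2) show ?thesis by (intro ucertI)
qed

text \<open>A single block with \<open>g = 0\<close> suffices, so the size does not grow. The
  arbitrary choice of this block is what spoils unambiguity.\<close>

lemma cert_nand_True:
  assumes "cert N g False w"
  shows "cert (n * N) (nand n N g) True w"
proof -
  obtain S where S: "certifies N g False w S" using assms by (rule certE)
  define i where "i = (\<lambda>x. SOME i. i < n \<and> \<not> g (blk N i x))"
  have i: "i x < n" "\<not> g (blk N (i x) x)" if "nand n N g x = True" for x
  proof -
    have "\<exists>i. i < n \<and> \<not> g (blk N i x)" using that by (auto simp: nand_def)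
    then have "i x < n \<and> \<not> g (blk N (i x) x)" unfolding i_def by (rule someI_ex)
    then show "i x < n" "\<not> g (blk N (i x) x)" by auto
  qed
  have "certifies (n * N) (nand n N g) True w (\<lambda>x. shift N (i x) (S (blk N (i x) x)))"
  proof (rule certifiesI)
    fix x assume x: "nand n N g x = True"
    show "shift N (i x) (S (blk N (i x) x)) \<subseteq> {..<n * N}"
      using certifiesD(1)[OF S] i[OF x] by (intro shift_subset) auto
    show "card (shift N (i x) (S (blk N (i x) x))) \<le> w"
      using certifiesD(2)[OF S] i[OF x] by simp
  next
    fix x y assume x: "nand n N g x = True"
      and xy: "\<And>v. v \<in> shift N (i x) (S (blk N (i x) x)) \<Longrightarrow> x v = y v"
    have "blk N (i x) x v = blk N (i x) y v" if "v \<in> S (blk N (i x) x)" for v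
      by (rule shift_agree[OF that xy])
    then have "\<not> g (blk N (i x) y)"
      using certifiesD(3)[OF S, of "blk N (i x) x" "blk N (i x) y"] i[OF x] by simp
    then show "nand n N g y = True" using i[OF x] by (auto simp: nand_def)
  qed
  then show ?thesis by (rule certI)
qed

text \<open>Unambiguity comes from certifying the first block with \<open>g = 0\<close> together with the
  fact that \<open>g = 1\<close> on all blocks before it.\<close>

lemma ucert_nand_True:
  assumes "ucert N g False u" "ucert N g True w"
  shows "ucert (n * N) (nand n N g) True (u + n * w)"
proof -
  obtain S0 where S0: "certifies N g False u S0" "unambiguous g False S0"
    using assms(1) by (rule ucertE)
  obtain S1 where S1: "certifies N g True w S1" "unambiguous g True S1"
    using assms(2) by (rule ucertE)
  define i where "i = (\<lambda>x. LEAST i. \<not> g (blk N i x))"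
  define S where "S = (\<lambda>x. shift N (i x) (S0 (blk N (i x) x)) \<union>
    (\<Union>j<i x. shift N j (S1 (blk N j x))))"
  have i: "i x < n" "\<not> g (blk N (i x) x)" "\<And>j. j < i x \<Longrightarrow> g (blk N j x)"
    if "nand n N g x = True" for x
  proof -
    have "\<exists>k<n. \<not> g (blk N k x)" using that by (auto simp: nand_def)
    then obtain k where k: "k < n" "\<not> g (blk N k x)" by blast
    then show "\<not> g (blk N (i x) x)" unfolding i_def by (metis (mono_tags) LeastI)
    show "i x < n" using k unfolding i_def by (meson Least_le le_less_trans)
    show "g (blk N j x)" if "j < i x" for j using that not_less_Least unfolding i_def by blast
  qed
  have *: "blk N (i x) x v = blk N (i x) y v" if "v \<in> S0 (blk N (i x) x)"
      "\<And>v. v \<in> S x \<Longrightarrow> x v = y v" for x y v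
    by (rule shift_agree[OF that(1)], rule that(2)) (auto simp: S_def)
  have **: "blk N j x v = blk N j y v" if "j < i x" "v \<in> S1 (blk N j x)"
      "\<And>v. v \<in> S x \<Longrightarrow> x v = y v" for x y j v
    by (rule shift_agree[OF that(2)], rule that(3)) (use that(1) in \<open>auto simp: S_def\<close>)
  have g0: "\<not> g (blk N (i x) y)" "S0 (blk N (i x) y) = S0 (blk N (i x) x)"
    if "nand n N g x = True" "\<And>v. v \<in> S x \<Longrightarrow> x v = y v" for x y
    using certifiesD(3)[OF S0(1), of "blk N (i x) x" "blk N (i x) y"]
      unambiguousD[OF S0(2), of "blk N (i x) x" "blk N (i x) y"]
      i(2)[OF that(1)] *[OF _ that(2)] by simp_all
  have g1: "g (blk N j y)" "S1 (blk N j y) = S1 (blk N j x)"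
    if "nand n N g x = True" "\<And>v. v \<in> S x \<Longrightarrow> x v = y v" "j < i x" for x y j
    using certifiesD(3)[OF S1(1), of "blk N j x" "blk N j y"]
      unambiguousD[OF S1(2), of "blk N j x" "blk N j y"]
      i(3)[OF that(1,3)] **[OF that(3) _ that(2)] by simp_all
  have "certifies (n * N) (nand n N g) True (u + n * w) S"
  proof (rule certifiesI)
    fix x assume x: "nand n N g x = True"
    have "shift N (i x) (S0 (blk N (i x) x)) \<subseteq> {..<n * N}"
      using certifiesD(1)[OF S0(1)] i[OF x] by (intro shift_subset) auto
    moreover have "shift N j (S1 (blk N j x)) \<subseteq> {..<n * N}" if "j < i x" for j
      using certifiesD(1)[OF S1(1), of "blk N j x"] i[OF x] that by (intro shift_subset) auto
    ultimately show "S x \<subseteq> {..<n * N}" by (auto simp: S_def)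
    have "card (S x) \<le> card (shift N (i x) (S0 (blk N (i x) x))) +
        card (\<Union>j<i x. shift N j (S1 (blk N j x)))"
      unfolding S_def by (rule card_Un_le)
    also have "\<dots> \<le> u + i x * w"
      using certifiesD(2)[OF S0(1), of "blk N (i x) x"] i[OF x] certifiesD(2)[OF S1(1)]
      by (intro add_mono card_UN_shift) auto
    also have "\<dots> \<le> u + n * w" using i(1)[OF x] by simp
    finally show "card (S x) \<le> u + n * w" .
  next
    fix x y assume "nand n N g x = True" "\<And>v. v \<in> S x \<Longrightarrow> x v = y v"
    then show "nand n N g y = True" using g0(1) i(1) unfolding nand_def by blast
  qed
  moreover have "unambiguous (nand n N g) True S"
  proof (rule unambiguousI)
    fix x y assume x: "nand n N g x = True" and xy: "\<And>v. v \<in> S x \<Longrightarrow> x v = y v"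
    note g0 = g0[OF x xy] and g1 = g1[OF x xy]
    have "(LEAST i. \<not> g (blk N i y)) = i x"
      using g0(1) g1(1) by (intro Least_equality) (auto simp: not_less [symmetric])
    then have "i y = i x" by (simp only: i_def)
    then show "S y = S x" using g0(2) g1(2) by (simp add: S_def)
  qed
  ultimately show ?thesis by (rule ucertI)
qed

section \<open>Certificates of labels and of cheat sheet functions\<close>

lemma total_certificate:
  assumes "certifies N g True w S1" "certifies N g False w S0"
  defines "S \<equiv> \<lambda>x. if g x then S1 x else S0 x"
  shows "S x \<subseteq> {..<N}" "card (S x) \<le> w" "(\<And>v. v \<in> S x \<Longrightarrow> x v = y v) \<Longrightarrow> g y = g x"
    "unambiguous g True S1 \<Longrightarrow> unambiguous g False S0 \<Longrightarrow>
       (\<And>v. v \<in> S x \<Longrightarrow> x v = y v) \<Longrightarrow> S y = S x"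
proof -
  show "S x \<subseteq> {..<N}" "card (S x) \<le> w"
    using certifiesD(1,2)[OF assms(1), of x] certifiesD(1,2)[OF assms(2), of x]
    by (auto simp: S_def)
  show *: "g y = g x" if "\<And>v. v \<in> S x \<Longrightarrow> x v = y v"
    using certifiesD(3)[OF assms(1), of x y] certifiesD(3)[OF assms(2), of x y] that
    by (cases "g x") (auto simp: S_def)
  show "S y = S x" if un: "unambiguous g True S1" "unambiguous g False S0"
    and xy: "\<And>v. v \<in> S x \<Longrightarrow> x v = y v"
    using unambiguousD[OF un(1), of x y] unambiguousD[OF un(2), of x y] xy *[OF xy]
    by (cases "g x") (auto simp: S_def)
qed

lemma label_certificate:
  assumes "\<And>x y. (\<And>v. v \<in> S x \<Longrightarrow> x v = y v) \<Longrightarrow> g y = g x"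
    and "\<And>v. v \<in> (\<Union>i<c. shift N i (S (blk N i x))) \<Longrightarrow> x v = y v"
  shows "label c N g y = label c N g x"
  unfolding label_eq_iff
proof (intro allI impI)
  fix i assume "i < c"
  show "g (blk N i y) = g (blk N i x)"
  proof (rule assms(1))
    fix v assume "v \<in> S (blk N i x)"
    then show "blk N i x v = blk N i y v"
      by (rule shift_agree, intro assms(2)) (use \<open>i < c\<close> in auto)
  qed
qed

text \<open>A label records the value of every copy, so ordinary certificates of both kinds are
  combined. This is the set of positions that a cheat sheet names.\<close>

lemma ex_label_certificate:
  assumes "cert N g True w" "cert N g False w"
  shows "\<exists>S\<subseteq>{..<c * N}. card S \<le> c * w \<and>
      (\<forall>y. (\<forall>v\<in>S. x v = y v) \<longrightarrow> label c N g y = label c N g x)"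
proof -
  obtain S1 where S1: "certifies N g True w S1" using assms(1) by (rule certE)
  obtain S0 where S0: "certifies N g False w S0" using assms(2) by (rule certE)
  note S = total_certificate[OF S1 S0]
  let ?S = "\<lambda>x. if g x then S1 x else S0 x"
  show ?thesis
    using S(1,2) label_certificate[where S = ?S and g = g and c = c and N = N and x = x, OF S(3)]
    by (intro exI[of _ "\<Union>i<c. shift N i (?S (blk N i x))"] conjI allI impI UN_least
          shift_subset card_UN_shift) auto
qed

definition advice :: "nat \<Rightarrow> nat \<Rightarrow> nat \<Rightarrow> ((nat \<Rightarrow> bool) \<Rightarrow> nat set option) \<Rightarrow>
    ((nat \<Rightarrow> bool) \<Rightarrow> bool) \<Rightarrow> (nat \<Rightarrow> bool) \<Rightarrow> nat set option" where
  "advice c N m dec g z = dec (\<lambda>t. z (c * N + label c N g z * m + t))"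

lemma cheat_iff:
  "cheat c N m dec g z \<longleftrightarrow> (\<exists>A. advice c N m dec g z = Some A \<and>
     (\<forall>y. (\<forall>v\<in>A. z v = y v) \<longrightarrow> label c N g y = label c N g z))"
  by (simp add: cheat_def advice_def split: option.split)

lemma advice_cong:
  assumes "decoder M w m dec" "label c N g y = label c N g z"
    "\<And>v. v \<in> sheet c N m (label c N g z) \<Longrightarrow> z v = y v"
  shows "advice c N m dec g y = advice c N m dec g z"
  unfolding advice_def
  by (rule depends_onD[of m dec]) (use assms in \<open>auto simp: decoder_def sheet_def\<close>)

lemma advice_bound:
  assumes "decoder M w m dec" "advice c N m' dec g z = Some A"
  shows "A \<subseteq> {..<M}" "card A \<le> w"
  using assms unfolding decoder_def advice_def by blast+

lemma sheet_eq: "sheet c N m l = (\<lambda>t. c * N + l * m + t) ` {..<m}"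
  by (auto simp: sheet_def)

lemma card_sheet: "card (sheet c N m l) = m"
  unfolding sheet_eq by (subst card_image) (auto simp: inj_on_def)

lemma sheet_subset: "l < 2 ^ c \<Longrightarrow> sheet c N m l \<subseteq> {..<c * N + 2 ^ c * m}"
  using block_index[of l "2 ^ c" _ m] by (auto simp: sheet_def)

text \<open>The certificate is the selected sheet with the positions it names. Those positions fix
  the label, the label fixes the sheet, and the sheet fixes the positions; since they are read from
  the input instead of being chosen, unambiguity needs nothing about certificates of
  \<open>g\<close>.\<close>

lemma ucert_cheat_True:
  assumes dec: "decoder (c * N) w m dec"
  shows "ucert (c * N + 2 ^ c * m) (cheat c N m dec g) True (m + w)"
proof -
  define S where "S = (\<lambda>z. sheet c N m (label c N g z) \<union> the (advice c N m dec g z))"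
  have main: "label c N g y = label c N g z" "advice c N m dec g y = advice c N m dec g z"
      "S y = S z" "cheat c N m dec g y = True"
    if z: "cheat c N m dec g z = True" and zy: "\<And>v. v \<in> S z \<Longrightarrow> z v = y v" for z y
  proof -
    from z obtain A where A: "advice c N m dec g z = Some A"
        "\<forall>y. (\<forall>v\<in>A. z v = y v) \<longrightarrow> label c N g y = label c N g z"
      unfolding cheat_iff simp_thms by (elim exE conjE)
    have zyA: "\<forall>v\<in>A. z v = y v" using zy A(1) by (simp add: S_def)
    show lab: "label c N g y = label c N g z" by (rule A(2)[rule_format, OF zyA[rule_format]])
    show adv: "advice c N m dec g y = advice c N m dec g z"
      by (rule advice_cong[OF dec lab zy]) (simp add: S_def)
    show "S y = S z" using lab adv by (simp add: S_def)
    have "label c N g y' = label c N g y" if "\<forall>v\<in>A. y v = y' v" for y'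
      unfolding lab by (rule A(2)[rule_format]) (use that zyA in simp)
    then show "cheat c N m dec g y = True"
      unfolding cheat_iff adv A(1) simp_thms by (intro exI[of _ A] conjI allI impI refl)
  qed
  have "certifies (c * N + 2 ^ c * m) (cheat c N m dec g) True (m + w) S"
  proof (rule certifiesI)
    fix z assume z: "cheat c N m dec g z = True"
    from z obtain A where A: "advice c N m dec g z = Some A"
      unfolding cheat_iff simp_thms by (elim exE conjE)
    then have "A \<subseteq> {..<c * N}" "card A \<le> w"
      using advice_bound[OF dec] by blast+
    then show "S z \<subseteq> {..<c * N + 2 ^ c * m}" "card (S z) \<le> m + w"
      unfolding S_def using sheet_subset[OF label_less[of c N g z], of N m]
        card_Un_le[of "sheet c N m (label c N g z)" A]
      by (auto simp: A card_sheet)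
  next
    fix z y assume "cheat c N m dec g z = True" "\<And>v. v \<in> S z \<Longrightarrow> z v = y v"
    then show "cheat c N m dec g y = True" by (rule main(4))
  qed
  moreover have "unambiguous (cheat c N m dec g) True S"
    by (rule unambiguousI) (rule main(3))
  ultimately show ?thesis by (rule ucertI)
qed

text \<open>Here the sheet is no help, so the label has to be certified through \<open>S\<close> on
  all copies. The sheet and the positions it names are added: either it decodes to
  \<open>None\<close>, or another input agrees on those positions and has a different label, and
  this same input then refutes the sheet for \<open>y\<close> too.\<close>

lemma cheat_False:
  assumes dec: "decoder (c * N) w m dec"
    and S: "\<And>x. S x \<subseteq> {..<N}" "\<And>x. card (S x) \<le> u"
      "\<And>x y. (\<And>v. v \<in> S x \<Longrightarrow> x v = y v) \<Longrightarrow> g y = g x"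
  defines "S' \<equiv> \<lambda>z. (\<Union>i<c. shift N i (S (blk N i z))) \<union> sheet c N m (label c N g z) \<union>
      (case advice c N m dec g z of None \<Rightarrow> {} | Some A \<Rightarrow> A)"
  shows "certifies (c * N + 2 ^ c * m) (cheat c N m dec g) False (c * u + m + w) S'"
    and "(\<And>x y. (\<And>v. v \<in> S x \<Longrightarrow> x v = y v) \<Longrightarrow> S y = S x) \<Longrightarrow>
      unambiguous (cheat c N m dec g) False S'"
proof -
  have lab: "label c N g y = label c N g z" if zy: "\<And>v. v \<in> S' z \<Longrightarrow> z v = y v" for z y
    by (rule label_certificate[of S], fact S(3), rule zy) (auto simp: S'_def)
  have adv: "advice c N m dec g y = advice c N m dec g z"
    if zy: "\<And>v. v \<in> S' z \<Longrightarrow> z v = y v" for z y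
    by (rule advice_cong[OF dec lab[OF zy] zy]) (auto simp: S'_def)
  show "certifies (c * N + 2 ^ c * m) (cheat c N m dec g) False (c * u + m + w) S'"
  proof (rule certifiesI)
    fix z
    define A where "A = (case advice c N m dec g z of None \<Rightarrow> {} | Some A \<Rightarrow> A)"
    have A: "A \<subseteq> {..<c * N}" "card A \<le> w"
      using advice_bound[OF dec] by (auto simp: A_def split: option.splits)
    have "shift N i (S (blk N i z)) \<subseteq> {..<c * N + 2 ^ c * m}" if "i < c" for i
      using shift_subset[OF S(1) that] by (rule order_trans) auto
    moreover have "A \<subseteq> {..<c * N + 2 ^ c * m}" using A(1) by auto
    ultimately show "S' z \<subseteq> {..<c * N + 2 ^ c * m}"
      using sheet_subset[OF label_less[of c N g z], of N m]
      unfolding S'_def A_def [symmetric] by (intro Un_least UN_least) auto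
    have "card (S' z) \<le> card (\<Union>i<c. shift N i (S (blk N i z))) + m + card A"
      unfolding S'_def A_def [symmetric]
      by (intro card_Un_le[THEN order_trans] add_mono) (simp_all add: card_sheet)
    also have "\<dots> \<le> c * u + m + w"
      using S(2) A(2) by (intro add_mono card_UN_shift) auto
    finally show "card (S' z) \<le> c * u + m + w" .
  next
    fix z y assume z: "cheat c N m dec g z = False" and zy: "\<And>v. v \<in> S' z \<Longrightarrow> z v = y v"
    show "cheat c N m dec g y = False"
    proof (cases "advice c N m dec g z")
      case None
      then show ?thesis using adv[OF zy] by (simp add: cheat_iff)
    next
      case (Some A)
      then obtain x where x: "\<forall>v\<in>A. z v = x v" "label c N g x \<noteq> label c N g z"
        using z unfolding cheat_iff by blast
      have "\<forall>v\<in>A. y v = x v" using x(1) zy Some by (simp add: S'_def)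
      then show ?thesis
        using Some x(2) adv[OF zy] lab[OF zy] unfolding cheat_iff by auto
    qed
  qed
  assume un: "\<And>x y. (\<And>v. v \<in> S x \<Longrightarrow> x v = y v) \<Longrightarrow> S y = S x"
  show "unambiguous (cheat c N m dec g) False S'"
  proof (rule unambiguousI)
    fix z y assume zy: "\<And>v. v \<in> S' z \<Longrightarrow> z v = y v"
    have "S (blk N i y) = S (blk N i z)" if "i < c" for i
    proof (rule un)
      fix v assume "v \<in> S (blk N i z)"
      then show "blk N i z v = blk N i y v"
        by (rule shift_agree, intro zy) (use \<open>i < c\<close> in \<open>auto simp: S'_def\<close>)
    qed
    then show "S' y = S' z"
      using lab[OF zy] adv[OF zy] by (simp add: S'_def)
  qed
qed

lemma cert_cheat_False:
  assumes "decoder (c * N) w m dec" "cert N g True u" "cert N g False u"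
  shows "cert (c * N + 2 ^ c * m) (cheat c N m dec g) False (c * u + m + w)"
proof -
  obtain S1 where S1: "certifies N g True u S1" using assms(2) by (rule certE)
  obtain S0 where S0: "certifies N g False u S0" using assms(3) by (rule certE)
  from cheat_False(1)[OF assms(1) total_certificate(1-3)[OF S1 S0]]
  show ?thesis by (rule certI)
qed

lemma ucert_cheat_False:
  assumes "decoder (c * N) w m dec" "ucert N g True u" "ucert N g False u"
  shows "ucert (c * N + 2 ^ c * m) (cheat c N m dec g) False (c * u + m + w)"
proof -
  obtain S1 where S1: "certifies N g True u S1" "unambiguous g True S1"
    using assms(2) by (rule ucertE)
  obtain S0 where S0: "certifies N g False u S0" "unambiguous g False S0"
    using assms(3) by (rule ucertE)
  note T = total_certificate[OF S1(1) S0(1)]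
  show ?thesis
    by (rule ucertI[OF cheat_False(1)[OF assms(1) T(1-3)] cheat_False(2)[OF assms(1) T(1-3) T(4)[OF S1(2) S0(2)]]])
qed

section \<open>Encoding of small sets\<close>

lemma card_small_subsets: "card {S. S \<subseteq> {..<M} \<and> card S \<le> w} \<le> (M + 1) ^ w"
proof -
  define L where "L = {xs. set xs \<subseteq> {..M} \<and> length xs = w}"
  have "S \<in> (\<lambda>xs. set xs \<inter> {..<M}) ` L" if S: "S \<subseteq> {..<M}" "card S \<le> w" for S
  proof
    have fin: "finite S" using S(1) finite_subset by blast
    \<comment> \<open>Padding with \<open>M\<close>, which the intersection with
      \<open>{..<M}\<close> removes again, gives all lists length \<open>w\<close>.\<close>
    let ?xs = "sorted_list_of_set S @ replicate (w - card S) M"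
    show "S = set ?xs \<inter> {..<M}" using S fin by (auto simp: set_replicate_conv_if)
    show "?xs \<in> L" using S fin by (auto simp: L_def set_replicate_conv_if)
  qed
  then have "card {S. S \<subseteq> {..<M} \<and> card S \<le> w} \<le> card ((\<lambda>xs. set xs \<inter> {..<M}) ` L)"
    by (intro card_mono) (auto simp: L_def finite_lists_length_eq)
  also have "\<dots> \<le> card L" by (rule card_image_le) (simp add: L_def finite_lists_length_eq)
  also have "card L = (M + 1) ^ w" by (simp add: L_def card_lists_length_eq)
  finally show ?thesis .
qed

lemma less_power_floorlog: "M < 2 ^ floorlog 2 M"
  using floorlog_bounds[of M 2] by (cases "M = 0") auto

lemma power_floorlog_le: "M > 0 \<Longrightarrow> 2 ^ floorlog 2 M \<le> 2 * M"
  using floorlog_bounds[of M 2] floorlog_eq_zero_iff[of 2 M]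
  by (cases "floorlog 2 M") auto

text \<open>The code of a set is a nonzero number written with \<open>m\<close> bits; zero is left over, so that an
  empty sheet encodes nothing.\<close>

lemma ex_decoder: "\<exists>dec. decoder M w (Suc (w * floorlog 2 M)) dec"
proof -
  define m where "m = Suc (w * floorlog 2 M)"
  define F where "F = {S. S \<subseteq> {..<M} \<and> card S \<le> w}"
  have fin: "finite F" by (simp add: F_def)
  have "card F \<le> (M + 1) ^ w" unfolding F_def by (rule card_small_subsets)
  also have "\<dots> \<le> (2 ^ floorlog 2 M) ^ w"
    using less_power_floorlog[of M] by (intro power_mono) auto
  also have "\<dots> = 2 ^ (m - 1)" by (simp add: m_def mult.commute flip: power_mult)
  \<comment> \<open>The extra bit from \<open>Suc\<close> leaves room to avoid the code 0.\<close>
  also have "\<dots> \<le> 2 ^ m - 1" by (simp add: m_def)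
  finally have "card F \<le> card {1..<2 ^ m :: nat}" by simp
  from card_le_inj[OF fin _ this] obtain enc :: "nat set \<Rightarrow> nat"
    where enc: "enc ` F \<subseteq> {1..<2 ^ m}" "inj_on enc F" by auto
  \<comment> \<open>With \<open>m\<close> blocks of one bit each, \<open>label\<close> is the number
    with binary digits \<open>s\<close>.\<close>
  define num where "num = label m 1 (\<lambda>x. x 0)"
  define dec where "dec = (\<lambda>s. if num s \<in> enc ` F then Some (inv_into F enc (num s)) else None)"
  have "depends_on m num"
    using depends_on_label[of 1 "\<lambda>x. x 0" m] by (simp add: num_def depends_on_def)
  then have "depends_on m dec" unfolding dec_def depends_on_def by metis
  moreover have "num (\<lambda>_. False) = 0"
    unfolding num_def by (rule label_eqI) (auto simp: blk_def)
  then have "dec (\<lambda>_. False) = None" using enc(1) by (auto simp: dec_def)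
  moreover have "S \<in> F" if "dec s = Some S" for s S
    using that inv_into_into[of "num s" enc F] by (auto simp: dec_def split: if_splits)
  moreover have "\<exists>s. dec s = Some S" if "S \<in> F" for S
  proof -
    have "num (bit (enc S)) = enc S"
      unfolding num_def using enc(1) that by (intro label_eqI) (auto simp: blk_def)
    then have "dec (bit (enc S)) = Some S"
      using that enc(2) by (simp add: dec_def inv_into_f_f)
    then show ?thesis by blast
  qed
  ultimately have "decoder M w m dec" unfolding decoder_def F_def by blast
  then show ?thesis unfolding m_def by blast
qed

subsection \<open>Bounds on \<open>RQ\<close> and \<open>UC\<close>\<close>

lemma restrict_cube: "restrict x {..<N} \<in> cube N"
  by (simp add: cube_def)

text \<open>Averaging over the random tree and over the inputs: an algorithm with fewer than
  \<open>d\<close> queries accepts with probability at least \<open>2/3\<close> under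
  \<open>p\<close> and at most \<open>1/3\<close> under \<open>q\<close>, but the gap can be at most
  \<open>\<delta>\<close> for each of its trees.\<close>

lemma RQ_ge:
  assumes hard: "hard N g d \<delta>" and \<delta>: "\<delta> < 1 / 3" and dep: "depends_on N g"
  shows "real (RQ N (restrict g (cube N))) \<ge> d"
proof -
  let ?f = "restrict g (cube N)"
  let ?P = "\<lambda>d. \<exists>A. rand_alg N d A \<and> computes_bounded_error N A ?f"
  have "\<exists>t. queried_vars t \<subseteq> {..<N} \<and> run t = g"
    using dep by (intro ex_tree) (auto simp: depends_on_def)
  then obtain t where t: "queried_vars t \<subseteq> {..<N}" "run t = g" by blast
  obtain D where D: "\<forall>x. queries t x \<le> D" using queries_bounded by blast
  have "?P D"
    using t D
    by (intro exI[of _ "return_pmf t"])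
       (auto simp: rand_alg_def computes_bounded_error_def indicator_def)
  then have "?P (RQ N ?f)" unfolding RQ_def by (rule LeastI)
  then obtain A where A: "rand_alg N (RQ N ?f) A" "computes_bounded_error N A ?f" by blast
  have vars: "queried_vars t \<subseteq> {..<N}" if "t \<in> set_pmf A" for t
    using A(1) that by (auto simp: rand_alg_def)
  \<comment> \<open>The distributions are not confined to \<open>cube N\<close>, whereas query
    bounds and correctness are given only there. Restricting an input does not affect the
    trees.\<close>
  have ext: "run t x = run t (restrict x {..<N})" "queries t x = queries t (restrict x {..<N})"
    if "t \<in> set_pmf A" for t x
  proof -
    have *: "x i = restrict x {..<N} i" if "i \<in> queried_vars t" for i
      using vars[OF \<open>t \<in> set_pmf A\<close>] that by auto
    show "run t x = run t (restrict x {..<N})" by (intro run_cong(1) *)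
    show "queries t x = queries t (restrict x {..<N})" by (intro run_cong(2) *)
  qed
  have correct: "pr A (\<lambda>t. run t x = g x) \<ge> 2 / 3" for x
  proof -
    have "g x = ?f (restrict x {..<N})"
      using depends_onD[OF dep, of x "restrict x {..<N}"] restrict_cube[of x N] by simp
    then have "pr A (\<lambda>t. run t (restrict x {..<N}) = ?f (restrict x {..<N})) \<le>
        pr A (\<lambda>t. run t x = g x)"
      using ext(1)[of _ x] by (intro pr_mono) simp
    then show ?thesis
      using A(2)[unfolded computes_bounded_error_def, rule_format, OF restrict_cube, of x]
      unfolding pr_def by (rule order_trans[rotated])
  qed
  show ?thesis
  proof (rule ccontr)
    assume "\<not> ?thesis"
    then have lt: "real (RQ N ?f) < d" by simp
    obtain p q where pq: "\<forall>x\<in>set_pmf p. g x" "\<forall>x\<in>set_pmf q. \<not> g x" "indist N d \<delta> p q"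
      using hard unfolding hard_def by blast
    \<comment> \<open>Fubini: the tree and the input are drawn independently, so in either
      order.\<close>
    have swap: "measure_pmf.expectation A (\<lambda>t. pr r (run t)) =
        measure_pmf.expectation r (\<lambda>x. pr A (\<lambda>t. run t x))" for r
    proof -
      have "measure_pmf.expectation A (\<lambda>t. pr r (run t)) =
          pr (bind_pmf A (\<lambda>t. bind_pmf r (\<lambda>x. return_pmf (run t x)))) (\<lambda>b. b)"
        by (simp add: pr_bind flip: map_pmf_def)
      also have "\<dots> = pr (bind_pmf r (\<lambda>x. bind_pmf A (\<lambda>t. return_pmf (run t x)))) (\<lambda>b. b)"
        by (subst bind_commute_pmf) (rule refl)
      also have "\<dots> = measure_pmf.expectation r (\<lambda>x. pr A (\<lambda>t. run t x))"
        by (simp add: pr_bind flip: map_pmf_def)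
      finally show ?thesis .
    qed
    have "(2 / 3 :: real) = measure_pmf.expectation p (\<lambda>x. 2 / 3)" by simp
    also have "\<dots> \<le> measure_pmf.expectation p (\<lambda>x. pr A (\<lambda>t. run t x))"
    proof (intro integral_mono_AE)
      have "2 / 3 \<le> pr A (\<lambda>t. run t x)" if "x \<in> set_pmf p" for x
        using correct[of x] pq(1) that by simp
      then show "AE x in measure_pmf p. 2 / 3 \<le> pr A (\<lambda>t. run t x)"
        by (simp add: AE_measure_pmf_iff)
    qed auto
    also have "\<dots> = measure_pmf.expectation A (\<lambda>t. pr p (run t))" by (simp add: swap)
    also have "\<dots> \<le> measure_pmf.expectation A (\<lambda>t. pr q (run t) + \<delta>)"
    proof (intro integral_mono_AE)
      have "pr p (run t) \<le> pr q (run t) + \<delta>" if t: "t \<in> set_pmf A" for t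
      proof -
        have "queries t x \<le> RQ N ?f" for x
          using A(1) t ext(2)[OF t, of x] restrict_cube[of x N] by (auto simp: rand_alg_def)
        then have "real (queries t x) < d" for x using lt by (meson le_less_trans of_nat_mono)
        then show ?thesis using pq(3) vars[OF t] by (simp add: indist_def)
      qed
      then show "AE t in measure_pmf A. pr p (run t) \<le> pr q (run t) + \<delta>"
        by (simp add: AE_measure_pmf_iff)
    qed auto
    also have "\<dots> = measure_pmf.expectation q (\<lambda>x. pr A (\<lambda>t. run t x)) + \<delta>"
      by (simp add: swap)
    also have "measure_pmf.expectation q (\<lambda>x. pr A (\<lambda>t. run t x)) \<le>
        measure_pmf.expectation q (\<lambda>x. 1 / 3)"
    proof (intro integral_mono_AE)
      have "pr A (\<lambda>t. run t x) \<le> 1 / 3" if "x \<in> set_pmf q" for x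
        using correct[of x] pq(2) that pr_not[of A "\<lambda>t. run t x"] by simp
      then show "AE x in measure_pmf q. pr A (\<lambda>t. run t x) \<le> 1 / 3"
        by (simp add: AE_measure_pmf_iff)
    qed auto
    finally show False using \<delta> by simp
  qed
qed

definition certificate_family ::
    "nat \<Rightarrow> ((nat \<Rightarrow> bool) \<Rightarrow> bool) \<Rightarrow> bool \<Rightarrow> nat \<Rightarrow> (nat \<rightharpoonup> bool) set \<Rightarrow> bool" where
  "certificate_family N f b w C \<longleftrightarrow>
     (\<forall>p\<in>C. b_certificate N f b p \<and> card (dom p) \<le> w) \<and>
     (\<forall>x\<in>cube N. f x = b \<longrightarrow> (\<exists>!p. p \<in> C \<and> consistent p x))"

lemma UC_side_eq: "UC_side b N f = (LEAST w. \<exists>C. certificate_family N f b w C)"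
  by (simp add: UC_side_def certificate_family_def)

lemma ex_certificate_family:
  assumes "ucert N g b w"
  shows "\<exists>C. certificate_family N (restrict g (cube N)) b w C"
proof -
  obtain S where S: "certifies N g b w S" "unambiguous g b S" using assms by (rule ucertE)
  define P where "P = (\<lambda>x v. if v \<in> S x then Some (x v) else None)"
  have cons: "consistent (P x) y \<longleftrightarrow> (\<forall>v\<in>S x. x v = y v)" for x y
    by (auto simp: consistent_def P_def)
  have dom: "dom (P x) = S x" for x by (auto simp: P_def dom_def)
  let ?f = "restrict g (cube N)"
  let ?C = "P ` {x \<in> cube N. g x = b}"
  have "b_certificate N ?f b (P x)" "card (dom (P x)) \<le> w" if "x \<in> cube N" "g x = b" for x
    unfolding b_certificate_def certificate_def dom
    using that certifiesD[OF S(1) that(2)] by (auto simp: cons intro!: bexI[of _ x])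
  moreover have "\<exists>!p. p \<in> ?C \<and> consistent p x" if x: "x \<in> cube N" "g x = b" for x
  proof (rule ex1I[of _ "P x"])
    show "P x \<in> ?C \<and> consistent (P x) x" using x by (simp add: cons)
  next
    fix p assume p: "p \<in> ?C \<and> consistent p x"
    then obtain y where y: "y \<in> cube N" "g y = b" "p = P y" by blast
    then have yx: "y v = x v" if "v \<in> S y" for v using p that by (simp add: cons)
    \<comment> \<open>The input \<open>x\<close> extends the certificate of \<open>y\<close>, so
      both have the same one.\<close>
    have "S x = S y" by (rule unambiguousD[OF S(2) y(2) yx])
    then show "p = P x" using yx by (auto simp: y(3) P_def fun_eq_iff)
  qed
  ultimately have "certificate_family N ?f b w ?C"
    unfolding certificate_family_def by auto
  then show ?thesis by blast
qed

lemma UC_side_le: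
  assumes "ucert N g b w"
  shows "UC_side b N (restrict g (cube N)) \<le> w"
  unfolding UC_side_eq using ex_certificate_family[OF assms] by (rule Least_le)

text \<open>A 0-certificate for the input with \<open>x1\<close> in every block must fix a variable
  of each block, since putting \<open>x0\<close> into an untouched block changes the value. This
  makes \<open>UC\<close> tend to infinity.\<close>

lemma UC_nand_ge:
  assumes dep: "depends_on N g" and x0: "\<not> g x0" and x1: "g x1"
    and cert: "ucert (n * N) (nand n N g) False w"
  shows "UC (n * N) (restrict (nand n N g) (cube (n * N))) \<ge> n"
proof -
  let ?M = "n * N" let ?f = "restrict (nand n N g) (cube (n * N))"
  let ?u = "UC_side False ?M ?f"
  have "\<exists>C. certificate_family ?M ?f False ?u C"
    unfolding UC_side_eq using ex_certificate_family[OF cert] by (rule LeastI)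
  then obtain C where C: "certificate_family ?M ?f False ?u C" by blast
  have cube_f: "?f (restrict x {..<?M}) = nand n N g x" for x
    using depends_onD[OF depends_on_nand[OF dep, of n], of x "restrict x {..<?M}"]
      restrict_cube[of x ?M] by simp
  have g_join: "g (blk N i (join n N B)) = g (B i)" if "i < n" for i B
    using that by (intro depends_onD[OF dep] blk_join)
  define z where "z = restrict (join n N (\<lambda>_. x1)) {..<?M}"
  have "?f z = False" unfolding z_def cube_f using g_join x1 by (auto simp: nand_def)
  moreover have "z \<in> cube ?M" unfolding z_def by (rule restrict_cube)
  ultimately obtain p where p: "p \<in> C" "consistent p z"
    using C unfolding certificate_family_def by blast
  then have p': "b_certificate ?M ?f False p" "card (dom p) \<le> ?u"
    using C unfolding certificate_family_def by blast+
  from p'(1) have dom: "dom p \<subseteq> {..<?M}"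
    and cert: "\<And>y. y \<in> cube ?M \<Longrightarrow> consistent p y \<Longrightarrow> ?f y = False"
    unfolding b_certificate_def certificate_def by auto
  have "\<exists>v\<in>dom p. v div N = i" if i: "i < n" for i
  proof (rule ccontr)
    assume none: "\<not> ?thesis"
    define B where "B = (\<lambda>_. x1)(i := x0)"
    let ?y = "restrict (join n N B) {..<?M}"
    have "consistent p ?y"
      unfolding consistent_def
    proof (intro allI impI)
      fix v b assume v: "p v = Some b"
      then have "v < ?M" "v div N \<noteq> i" using dom none by auto
      then have "?y v = z v" by (simp add: z_def B_def join_def)
      then show "?y v = b" using p(2) v by (simp add: consistent_def)
    qed
    then have "?f ?y = False" by (rule cert[OF restrict_cube])
    moreover have "nand n N g (join n N B)"
      using i g_join[OF i, of B] x0 by (auto simp: nand_def B_def)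
    ultimately show False unfolding cube_f by simp
  qed
  then have "{..<n} \<subseteq> (\<lambda>v. v div N) ` dom p" by force
  then have "card {..<n} \<le> card (dom p)"
    using finite_subset[OF dom] by (intro surj_card_le) auto
  then show ?thesis using p'(2) by (simp add: UC_def)
qed

subsection \<open>Asymptotics\<close>

definition soft_poly :: "nat \<Rightarrow> (nat \<Rightarrow> nat) \<Rightarrow> bool" where
  "soft_poly k X \<longleftrightarrow> (\<lambda>n. real (X n)) \<in> soft_bigo (\<lambda>n. real n ^ k)"

lemma eventually_ln_ge: "eventually (\<lambda>n. ln (real n) \<ge> C) sequentially"
  by real_asymp

lemma soft_poly_iff:
  "soft_poly k X \<longleftrightarrow>
     (\<exists>c C. eventually (\<lambda>n. real (X n) \<le> C * real n ^ k * ln (real n) ^ c) sequentially)"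
proof
  assume "soft_poly k X"
  then obtain c where "(\<lambda>n. real (X n)) \<in> O(\<lambda>n. real n ^ k * ln (real n) ^ c)"
    by (auto simp: soft_poly_def soft_bigo_def)
  then obtain C where C: "eventually (\<lambda>n. norm (real (X n)) \<le> C * norm (real n ^ k * ln (real n) ^ c)) sequentially"
    by (elim landau_o.bigE)
  have "eventually (\<lambda>n. real (X n) \<le> C * real n ^ k * ln (real n) ^ c) sequentially"
    using C eventually_ln_ge[of 0] by eventually_elim (simp add: abs_mult power_abs mult.assoc)
  then show "\<exists>c C. eventually (\<lambda>n. real (X n) \<le> C * real n ^ k * ln (real n) ^ c) sequentially"
    by blast
next
  assume "\<exists>c C. eventually (\<lambda>n. real (X n) \<le> C * real n ^ k * ln (real n) ^ c) sequentially"
  then obtain c C where C: "eventually (\<lambda>n. real (X n) \<le> C * real n ^ k * ln (real n) ^ c) sequentially"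
    by blast
  have "(\<lambda>n. real (X n)) \<in> O(\<lambda>n. real n ^ k * ln (real n) ^ c)"
    using C eventually_ln_ge[of 0]
    \<comment> \<open>The constant in \<open>landau_o.bigI\<close> has to be positive, and
      \<open>C\<close> need not be.\<close>
    by (intro landau_o.bigI[of "max C 1"], simp, eventually_elim)
       (simp add: abs_mult power_abs mult.assoc,
        smt (verit) max.cobounded1 mult_right_mono mult_nonneg_nonneg of_nat_0_le_iff zero_le_power)
  then show "soft_poly k X" by (auto simp: soft_poly_def soft_bigo_def)
qed

lemma soft_poly_le:
  assumes "soft_poly k Y" "\<And>n. X n \<le> Y n"
  shows "soft_poly k X"
proof -
  obtain c C where "eventually (\<lambda>n. real (Y n) \<le> C * real n ^ k * ln (real n) ^ c) sequentially"
    using assms(1) by (auto simp: soft_poly_iff)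
  then have "eventually (\<lambda>n. real (X n) \<le> C * real n ^ k * ln (real n) ^ c) sequentially"
    by eventually_elim (use assms(2) in \<open>meson le_trans of_nat_mono order_trans\<close>)
  then show ?thesis by (auto simp: soft_poly_iff)
qed

lemma soft_poly_mult:
  assumes "soft_poly j X" "soft_poly k Y"
  shows "soft_poly (j + k) (\<lambda>n. X n * Y n)"
proof -
  obtain c d where "(\<lambda>n. real (X n)) \<in> O(\<lambda>n. real n ^ j * ln (real n) ^ c)"
    "(\<lambda>n. real (Y n)) \<in> O(\<lambda>n. real n ^ k * ln (real n) ^ d)"
    using assms by (auto simp: soft_poly_def soft_bigo_def)
  from landau_o.big_mult[OF this]
  have "(\<lambda>n. real (X n * Y n)) \<in> O(\<lambda>n. real n ^ (j + k) * ln (real n) ^ (c + d))"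
    by (simp add: power_add mult_ac)
  then show ?thesis unfolding soft_poly_def soft_bigo_def by blast
qed

lemma soft_poly_const: "soft_poly 0 (\<lambda>_. C)"
  unfolding soft_poly_def soft_bigo_def by (intro CollectI exI[of _ 0]) simp

lemma soft_poly_id: "soft_poly 1 (\<lambda>n. n)"
  unfolding soft_poly_def soft_bigo_def by (intro CollectI exI[of _ 0]) simp

lemma soft_poly_raise:
  assumes "soft_poly j X" "j \<le> k"
  shows "soft_poly k X"
proof -
  obtain c where "(\<lambda>n. real (X n)) \<in> O(\<lambda>n. real n ^ j * ln (real n) ^ c)"
    using assms by (auto simp: soft_poly_def soft_bigo_def)
  also have "(\<lambda>n. real n ^ j * ln (real n) ^ c) \<in> O(\<lambda>n. real n ^ k * ln (real n) ^ c)"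
    using eventually_ge_at_top[of 1]
    by (intro landau_o.big_mult landau_o.bigI[of 1], simp, eventually_elim)
       (use assms(2) in \<open>auto intro: power_increasing\<close>)
  finally show ?thesis by (auto simp: soft_poly_def soft_bigo_def)
qed

lemma soft_poly_add:
  assumes "soft_poly k X" "soft_poly k Y"
  shows "soft_poly k (\<lambda>n. X n + Y n)"
proof -
  obtain c d where cd: "(\<lambda>n. real (X n)) \<in> O(\<lambda>n. real n ^ k * ln (real n) ^ c)"
    "(\<lambda>n. real (Y n)) \<in> O(\<lambda>n. real n ^ k * ln (real n) ^ d)"
    using assms by (auto simp: soft_poly_def soft_bigo_def)
  have raise: "(\<lambda>n. real n ^ k * ln (real n) ^ c) \<in> O(\<lambda>n. real n ^ k * ln (real n) ^ c')"
    if "c \<le> c'" for c c'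
  proof -
    have "(\<lambda>n. ln (real n) ^ c) \<in> O(\<lambda>n. ln (real n) ^ c')"
      using eventually_ln_ge[of 1]
      by (intro landau_o.bigI[of 1], simp, eventually_elim)
         (use that in \<open>auto simp: power_abs intro: power_increasing\<close>)
    then show ?thesis by (rule landau_o.big_mult[OF landau_o.big_refl])
  qed
  have "(\<lambda>n. real (X n) + real (Y n)) \<in> O(\<lambda>n. real n ^ k * ln (real n) ^ (max c d))"
    by (intro sum_in_bigo landau_o.big_trans[OF cd(1) raise] landau_o.big_trans[OF cd(2) raise]) auto
  then show ?thesis unfolding soft_poly_def soft_bigo_def by auto
qed

lemma soft_poly_power: "soft_poly k (\<lambda>n. n ^ k)"
  unfolding soft_poly_def soft_bigo_def by (intro CollectI exI[of _ 0]) simp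

text \<open>One more factor \<open>n\<close> absorbs every power of the logarithm.\<close>

lemma soft_poly_bound:
  assumes "soft_poly k X"
  shows "eventually (\<lambda>n. X n \<le> n ^ (k + 1)) sequentially"
proof -
  obtain c C where C: "eventually (\<lambda>n. real (X n) \<le> C * real n ^ k * ln (real n) ^ c) sequentially"
    using assms by (auto simp: soft_poly_iff)
  have "(\<lambda>n. C * ln (real n) ^ c) \<in> o(\<lambda>n. real n)"
    by real_asymp
  then have "eventually (\<lambda>n. norm (C * ln (real n) ^ c) \<le> 1 * norm (real n)) sequentially"
    by (rule landau_o.smallD) simp
  with C show ?thesis
  proof eventually_elim
    case (elim n)
    have "real (X n) \<le> real n ^ k * (C * ln (real n) ^ c)" using elim(1) by (simp add: mult_ac)
    also have "\<dots> \<le> real n ^ k * real n" using elim(2) by (intro mult_left_mono) auto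
    finally have "real (X n) \<le> real (n ^ (k + 1))" by (simp add: mult.commute)
    then show ?case by (simp only: of_nat_le_iff)
  qed
qed

lemma soft_poly_floorlog:
  assumes "soft_poly k X"
  shows "soft_poly 0 (\<lambda>n. floorlog 2 (X n))"
proof -
  \<comment> \<open>From \<open>ln 2 >= 1/2\<close> and \<open>ln 2 <= ln n\<close> the constant
    \<open>2 * (k + 2)\<close> results; \<open>4 * k + 8\<close> leaves slack.\<close>
  have "eventually (\<lambda>n. real (floorlog 2 (X n)) \<le> real (4 * k + 8) * real n ^ 0 * ln (real n) ^ 1) sequentially"
    using soft_poly_bound[OF assms] eventually_ln_ge[of 1] eventually_ge_at_top[of 2]
  proof eventually_elim
    case (elim n)
    have "2 ^ floorlog 2 (X n) \<le> 2 * n ^ (k + 1)"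
    proof (cases "X n = 0")
      case True
      then show ?thesis using elim(3) by (simp add: floorlog_def)
    next
      case False
      then show ?thesis using power_floorlog_le[of "X n"] elim(1) by linarith
    qed
    then have "real (2 ^ floorlog 2 (X n)) \<le> real (2 * n ^ (k + 1))" by (simp only: of_nat_le_iff)
    then have "ln (2 ^ floorlog 2 (X n)) \<le> ln (2 * real n ^ (k + 1))"
      using elim(3) by (subst ln_le_cancel_iff) auto
    then have "floorlog 2 (X n) * ln 2 \<le> ln 2 + (k + 1) * ln n"
      using elim(3) by (simp add: ln_realpow ln_mult algebra_simps)
    moreover have "ln 2 \<le> ln (real n)" using elim(3) by simp
    moreover have "floorlog 2 (X n) * (1 / 2) \<le> floorlog 2 (X n) * ln (2::real)"
      using ln2_ge_two_thirds by (intro mult_left_mono) auto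
    ultimately have "real (floorlog 2 (X n)) \<le> 2 * (k + 2) * ln n"
      by (simp add: algebra_simps)
    also have "\<dots> \<le> (4 * k + 8) * ln n" using elim(2) by (intro mult_right_mono) auto
    finally show ?case by simp
  qed
  then show ?thesis unfolding soft_poly_iff by blast
qed

text \<open>\<open>M\<close> may depend on \<open>K\<close>. Each step of the construction can thus
  demand a smaller advantage from the step before and pay with a power of the logarithm in the query
  bound only.\<close>

definition hard_family :: "nat \<Rightarrow> (nat \<Rightarrow> nat) \<Rightarrow> (nat \<Rightarrow> (nat \<Rightarrow> bool) \<Rightarrow> bool) \<Rightarrow> bool" where
  "hard_family k N g \<longleftrightarrow> (\<forall>K. \<exists>M. eventually (\<lambda>n.
     hard (N n) (g n) (real n ^ k / ln (real n) ^ M) (1 / ln (real n) ^ K)) sequentially)"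

text \<open>Hardness with exponent \<open>Suc K\<close> is combined with
  \<open>\<epsilon> = 1 / ln n ^ Suc K\<close>. The two errors together stay below
  \<open>1 / ln n ^ K\<close> once \<open>ln n >= 2\<close>.\<close>

lemma hard_family_nand:
  assumes "hard_family k N g" and dep: "\<And>n. depends_on (N n) (g n)"
  shows "hard_family (Suc k) (\<lambda>n. n * N n) (\<lambda>n. nand n (N n) (g n))"
  unfolding hard_family_def
proof
  fix K
  obtain M where M: "eventually (\<lambda>n.
     hard (N n) (g n) (real n ^ k / ln (real n) ^ M) (1 / ln (real n) ^ Suc K)) sequentially"
    using assms(1) unfolding hard_family_def by blast
  have "eventually (\<lambda>n. hard (n * N n) (nand n (N n) (g n))
      (real n ^ Suc k / ln (real n) ^ (M + Suc K)) (1 / ln (real n) ^ K)) sequentially"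
    using M eventually_ln_ge[of 2] eventually_ge_at_top[of 2]
  proof eventually_elim
    case (elim n)
    have "hard (n * N n) (nand n (N n) (g n))
        (real n * (1 / ln (real n) ^ Suc K) * (real n ^ k / ln (real n) ^ M))
        (1 / ln (real n) ^ Suc K + 1 / ln (real n) ^ Suc K)"
      using elim(2,3) by (intro hard_nand[OF elim(1) _ _ dep]) auto
    then show ?case
    proof (rule hard_mono)
      show "real n ^ Suc k / ln (real n) ^ (M + Suc K) \<le>
          real n * (1 / ln (real n) ^ Suc K) * (real n ^ k / ln (real n) ^ M)"
        by (simp add: power_add mult_ac)
      show "1 / ln (real n) ^ Suc K + 1 / ln (real n) ^ Suc K \<le> 1 / ln (real n) ^ K"
        using elim(2) by (simp add: divide_simps)
    qed
  qed
  then show "\<exists>M. eventually (\<lambda>n. hard (n * N n) (nand n (N n) (g n))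
      (real n ^ Suc k / ln (real n) ^ M) (1 / ln (real n) ^ K)) sequentially"
    by blast
qed

text \<open>Demanding exponent \<open>K + e + 1\<close> makes up for the factor \<open>c n\<close>:
  the part \<open>e\<close> cancels its logarithms and the last factor beats its constant
  \<open>C\<close>. The other error is at most \<open>1 / n\<close>, since \<open>2 ^ c n\<close>
  exceeds the query bound by a factor \<open>n\<close>.\<close>

lemma hard_family_cheat:
  fixes N c :: "nat \<Rightarrow> nat"
  assumes hard: "hard_family k N g" and c: "soft_poly 0 c" "\<And>n. n ^ Suc k \<le> 2 ^ c n"
    and cert: "\<And>n. cert (N n) (g n) True (u n)" "\<And>n. cert (N n) (g n) False (u n)"
    and dec: "\<And>n. decoder (c n * N n) (c n * u n) (m n) (dec n)"
  shows "hard_family k (\<lambda>n. c n * N n + 2 ^ c n * m n)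
    (\<lambda>n. cheat (c n) (N n) (m n) (dec n) (g n))"
  unfolding hard_family_def
proof
  fix K
  obtain e C where C: "eventually (\<lambda>n. real (c n) \<le> C * real n ^ 0 * ln (real n) ^ e) sequentially"
    using c(1) by (auto simp: soft_poly_iff)
  obtain M where M: "eventually (\<lambda>n.
     hard (N n) (g n) (real n ^ k / ln (real n) ^ M) (1 / ln (real n) ^ (K + e + 1))) sequentially"
    using hard unfolding hard_family_def by blast
  have small: "eventually (\<lambda>n. ln (real n) ^ K / n \<le> 1 / 2) sequentially"
  proof -
    have "(\<lambda>n. ln (real n) ^ K) \<in> o(\<lambda>n. real n)" by real_asymp
    then have "eventually (\<lambda>n. norm (ln (real n) ^ K) \<le> 1 / 2 * norm (real n)) sequentially"
      by (rule landau_o.smallD) simp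
    then show ?thesis using eventually_gt_at_top[of 0]
      by eventually_elim (simp add: field_simps)
  qed
  have "eventually (\<lambda>n. hard (c n * N n + 2 ^ c n * m n)
     (cheat (c n) (N n) (m n) (dec n) (g n))
      (real n ^ k / ln (real n) ^ M) (1 / ln (real n) ^ K)) sequentially"
    using M C small eventually_ln_ge[of "max 1 (2 * C)"] eventually_ge_at_top[of 2]
  proof eventually_elim
    case (elim n)
    define L where "L = ln (real n)"
    define d where "d = real n ^ k / L ^ M"
    have L: "L \<ge> 1" "2 * C \<le> L" using elim(4) by (auto simp: L_def)
    have d: "d > 0" "d \<le> real n ^ k" using L elim(5) by (auto simp: d_def divide_simps)
    have "hard (c n * N n + 2 ^ c n * m n) (cheat (c n) (N n) (m n) (dec n) (g n)) d
        (c n * (1 / L ^ (K + e + 1)) + d / 2 ^ c n)"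
      using elim(1) d(1) L dec[of n] ex_label_certificate[OF cert(1)[of n] cert(2)[of n]]
        depends_on_of_cert[OF cert(1)[of n] cert(2)[of n]]
      by (intro hard_cheat[where w = "c n * u n"]) (auto simp: d_def L_def)
    moreover have "c n * (1 / L ^ (K + e + 1)) + d / 2 ^ c n \<le> 1 / L ^ K"
    proof -
      have "c n * (1 / L ^ (K + e + 1)) \<le> (C * L ^ e) * (1 / L ^ (K + e + 1))"
        using elim(2) L by (intro mult_right_mono) (auto simp: L_def)
      also have "\<dots> = C / L * (1 / L ^ K)" using L by (simp add: power_add)
      also have "\<dots> \<le> 1 / 2 * (1 / L ^ K)"
        using L by (intro mult_right_mono) (auto simp: divide_simps)
      finally have 1: "c n * (1 / L ^ (K + e + 1)) \<le> 1 / 2 * (1 / L ^ K)" .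
      have "d / 2 ^ c n \<le> real n ^ k / real n ^ Suc k"
      proof (rule frac_le)
        have "real (n ^ Suc k) \<le> real (2 ^ c n)" using c(2)[of n] by (simp only: of_nat_le_iff)
        then show "real n ^ Suc k \<le> 2 ^ c n" by simp
      qed (use d elim(5) in auto)
      also have "\<dots> = 1 / n" using elim(5) by simp
      also have "\<dots> = L ^ K / n * (1 / L ^ K)" using L by simp
      also have "\<dots> \<le> 1 / 2 * (1 / L ^ K)"
        using elim(3) L by (intro mult_right_mono) (auto simp: L_def)
      finally show ?thesis using 1 by simp
    qed
    ultimately show ?case
      unfolding L_def [symmetric] d_def [symmetric] by (rule hard_mono[OF _ order_refl])
  qed
  then show "\<exists>M. eventually (\<lambda>n. hard (c n * N n + 2 ^ c n * m n)
     (cheat (c n) (N n) (m n) (dec n) (g n))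
      (real n ^ k / ln (real n) ^ M) (1 / ln (real n) ^ K)) sequentially"
    by blast
qed

text \<open>Only 0-inputs may have large unambiguous certificates; ordinary certificates and unambiguous
  1-certificates are smaller by a factor \<open>n\<close>.\<close>

definition separation :: "nat \<Rightarrow> (nat \<Rightarrow> nat) \<Rightarrow> (nat \<Rightarrow> (nat \<Rightarrow> bool) \<Rightarrow> bool) \<Rightarrow>
    (nat \<Rightarrow> nat) \<Rightarrow> (nat \<Rightarrow> nat) \<Rightarrow> bool" where
  "separation k N g a b \<longleftrightarrow>
     (\<forall>n. ucert (N n) (g n) True (a n) \<and> cert (N n) (g n) False (a n) \<and>
          ucert (N n) (g n) False (b n)) \<and>
     soft_poly k a \<and> soft_poly (k + 1) b \<and> (\<exists>A. soft_poly A N) \<and> hard_family (2 * k) N g"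

section \<open>The induction on \<open>k\<close>\<close>

lemma separation_0: "separation 0 (\<lambda>_. 1) (\<lambda>_ x. x 0) (\<lambda>_. 1) (\<lambda>_. 1)"
proof -
  let ?g = "\<lambda>x::nat \<Rightarrow> bool. x 0"
  have u: "ucert 1 ?g b 1" for b
    by (rule ucertI[of _ _ _ _ "\<lambda>_. {0}"]) (auto simp: certifies_def unambiguous_def)
  have "hard 1 ?g 1 \<delta>" if "\<delta> \<ge> 0" for \<delta>
    unfolding hard_def
  proof (intro exI conjI)
    show "\<forall>x\<in>set_pmf (return_pmf (\<lambda>_. True)). ?g x" "\<forall>x\<in>set_pmf (return_pmf (\<lambda>_. False)). \<not> ?g x"
      by auto
    show "indist 1 1 \<delta> (return_pmf (\<lambda>_. True)) (return_pmf (\<lambda>_. False))"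
      unfolding indist_def
    proof (intro allI impI)
      \<comment> \<open>A tree without queries is constant and accepts both point masses equally
        often.\<close>
      fix t assume "\<forall>x. real (queries t x) < 1"
      then have "queries t (\<lambda>_. True) = 0" by simp
      then obtain b where "t = Answer b" by (cases t) auto
      then show "pr (return_pmf (\<lambda>_. True)) (run t) \<le> pr (return_pmf (\<lambda>_. False)) (run t) + \<delta>"
        using that by (simp add: pr_def indicator_def)
    qed
  qed
  then have "hard_family 0 (\<lambda>_. 1) (\<lambda>_. ?g)"
    unfolding hard_family_def
    by (intro allI exI[of _ 0] eventually_mono[OF eventually_ln_ge[of 0]]) simp
  then show ?thesis
    unfolding separation_def
    using u cert_of_ucert[OF u] soft_poly_const[of 1] soft_poly_raise[OF soft_poly_const[of 1], of 1]
    by auto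
qed

lemma separation_depends_on: "separation k N g a b \<Longrightarrow> depends_on (N n) (g n)"
  unfolding separation_def by (meson cert_of_ucert depends_on_of_cert)

text \<open>The large size \<open>b\<close> enters only once, for the first block of value 0, and
  not with a factor \<open>n\<close>. Both unambiguous sizes therefore have degree
  \<open>k + 1\<close>, while ordinary 1-certificates keep size \<open>a\<close> for the next
  NAND.\<close>

lemma separation_nand:
  assumes "separation k N g a b"
  shows "hard_family (2 * k + 1) (\<lambda>n. n * N n) (\<lambda>n. nand n (N n) (g n))"
    "ucert (n * N n) (nand n (N n) (g n)) False (n * a n)"
    "ucert (n * N n) (nand n (N n) (g n)) True (b n + n * a n)"
    "cert (n * N n) (nand n (N n) (g n)) True (a n)"
    "soft_poly (k + 1) (\<lambda>n. n * a n)" "soft_poly (k + 1) (\<lambda>n. b n + n * a n)"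
proof -
  note sep = assms[unfolded separation_def]
  show "hard_family (2 * k + 1) (\<lambda>n. n * N n) (\<lambda>n. nand n (N n) (g n))"
    using hard_family_nand[of "2 * k" N g] separation_depends_on[OF assms] sep by simp
  show "ucert (n * N n) (nand n (N n) (g n)) False (n * a n)"
    "ucert (n * N n) (nand n (N n) (g n)) True (b n + n * a n)"
    "cert (n * N n) (nand n (N n) (g n)) True (a n)"
    using sep by (auto intro: ucert_nand_False ucert_nand_True cert_nand_True)
  show na: "soft_poly (k + 1) (\<lambda>n. n * a n)"
    using soft_poly_mult[OF soft_poly_id, of k a] sep by (simp add: add.commute)
  then show "soft_poly (k + 1) (\<lambda>n. b n + n * a n)"
    using sep by (intro soft_poly_add) auto
qed

lemma separation_Suc:
  assumes sep: "separation k N g a b"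
  shows "\<exists>N g a b. separation (Suc k) N g a b"
proof -
  note f = separation_nand[OF sep]
  define H where "H = (\<lambda>n. n * (n * N n))"
  define h where "h = (\<lambda>n. nand n (n * N n) (nand n (N n) (g n)))"
  \<comment> \<open>A common bound for the unambiguous certificates of \<open>h\<close> of both
    values, of degree \<open>k + 2\<close>.\<close>
  define u where "u = (\<lambda>n. n * a n + n * (b n + n * a n))"
  \<comment> \<open>The query bound of \<open>h\<close> has degree \<open>2 * k + 2\<close>, and
    \<open>hard_family_cheat\<close> wants one factor \<open>n\<close> more in
    \<open>2 ^ c\<close>.\<close>
  define c where "c = (\<lambda>n. floorlog 2 (n ^ (2 * k + 3)))"
  \<comment> \<open>The size of a label certificate: \<open>c\<close> copies, each with an ordinary
    certificate of size \<open>n * a\<close>.\<close>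
  define w where "w = (\<lambda>n. c n * (n * a n))"
  define m where "m = (\<lambda>n. Suc (w n * floorlog 2 (c n * H n)))"
  have "\<forall>n. \<exists>dec. decoder (c n * H n) (w n) (m n) dec"
    unfolding m_def using ex_decoder by blast
  from choice[OF this] obtain dec where dec: "\<And>n. decoder (c n * H n) (w n) (m n) (dec n)"
    by blast
  have dep: "depends_on (n * N n) (nand n (N n) (g n))" for n
    by (intro depends_on_nand separation_depends_on[OF sep])
  have hard_h: "hard_family (2 * k + 2) H h"
    unfolding H_def h_def using hard_family_nand[OF f(1) dep] by simp
  have cert_h: "cert (H n) (h n) True (n * a n)" "cert (H n) (h n) False (n * a n)" for n
    unfolding H_def h_def
    using cert_nand_True[OF cert_of_ucert[OF f(2)]] cert_nand_False[OF f(4)] by auto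
  have ucert_h: "ucert (H n) (h n) True (u n)" "ucert (H n) (h n) False (u n)" for n
  proof -
    show "ucert (H n) (h n) True (u n)"
      unfolding H_def h_def u_def by (rule ucert_nand_True[OF f(2,3)])
    show "ucert (H n) (h n) False (u n)"
      unfolding H_def h_def u_def by (rule ucert_mono[OF ucert_nand_False[OF f(3)]]) simp
  qed
  obtain A where A: "soft_poly A N" using sep unfolding separation_def by blast
  have soft_c: "soft_poly 0 c"
    unfolding c_def by (rule soft_poly_floorlog[OF soft_poly_power])
  have soft_H: "soft_poly (1 + (1 + A)) H"
    unfolding H_def by (intro soft_poly_mult soft_poly_id A)
  have soft_w: "soft_poly (Suc k) w"
    unfolding w_def using soft_poly_mult[OF soft_c f(5)] by simp
  have "soft_poly (Suc k + 0) (\<lambda>n. w n * floorlog 2 (c n * H n))"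
    by (intro soft_poly_mult soft_w soft_poly_floorlog[OF soft_poly_mult[OF soft_c soft_H]])
  from soft_poly_add[OF this soft_poly_raise[OF soft_poly_const[of 1] le0]]
  have soft_m: "soft_poly (Suc k) m" by (simp add: m_def)
  have "soft_poly (1 + (k + 1)) (\<lambda>n. n * (b n + n * a n))"
    by (intro soft_poly_mult soft_poly_id f)
  then have soft_u: "soft_poly (Suc k + 1) u"
    unfolding u_def by (intro soft_poly_add soft_poly_raise[OF f(5)]) auto
  define N' where "N' = (\<lambda>n. c n * H n + 2 ^ c n * m n)"
  define g' where "g' = (\<lambda>n. cheat (c n) (H n) (m n) (dec n) (h n))"
  define a' where "a' = (\<lambda>n. c n * (n * a n) + m n + w n)"
  define b' where "b' = (\<lambda>n. c n * u n + m n + w n)"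
  have "separation (Suc k) N' g' a' b'"
    unfolding separation_def
  proof (intro conjI allI)
    show "ucert (N' n) (g' n) True (a' n)" for n
      unfolding N'_def g'_def a'_def by (rule ucert_mono[OF ucert_cheat_True[OF dec]]) simp
    show "cert (N' n) (g' n) False (a' n)" for n
      unfolding N'_def g'_def a'_def by (rule cert_cheat_False[OF dec cert_h])
    show "ucert (N' n) (g' n) False (b' n)" for n
      unfolding N'_def g'_def b'_def by (rule ucert_cheat_False[OF dec ucert_h])
    show "soft_poly (Suc k) a'"
      unfolding a'_def using soft_w by (intro soft_poly_add soft_m) (auto simp: w_def)
    have "soft_poly (Suc k + 1) (\<lambda>n. c n * u n)"
      using soft_poly_mult[OF soft_c soft_u] by simp
    then show "soft_poly (Suc k + 1) b'"
      unfolding b'_def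
      by (intro soft_poly_add soft_poly_raise[OF soft_m] soft_poly_raise[OF soft_w]) auto
    show "hard_family (2 * Suc k) N' g'"
      unfolding N'_def g'_def
    proof (rule hard_family_cheat[OF _ soft_c _ cert_h])
      show "hard_family (2 * Suc k) H h" using hard_h by simp
      show "n ^ Suc (2 * Suc k) \<le> 2 ^ c n" for n
        using less_power_floorlog[of "n ^ (2 * k + 3)"] by (simp add: c_def numeral_3_eq_3)
      show "decoder (c n * H n) (c n * (n * a n)) (m n) (dec n)" for n
        using dec[of n] by (simp add: w_def)
    qed
    have "soft_poly (2 * k + 3) (\<lambda>n. 2 ^ c n)"
    proof (rule soft_poly_le)
      have "soft_poly (2 * k + 3 + 0) (\<lambda>n. n ^ (2 * k + 3) * 2)"
        by (intro soft_poly_mult soft_poly_power soft_poly_const)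
      then show "soft_poly (2 * k + 3) (\<lambda>n. n ^ (2 * k + 3) * 2 + 1)"
        by (intro soft_poly_add soft_poly_raise[OF soft_poly_const[of 1]]) auto
      \<comment> \<open>The summand 1 covers \<open>n = 0\<close>, where \<open>floorlog\<close> is
        0 and the power of two is 1.\<close>
      show "2 ^ c n \<le> n ^ (2 * k + 3) * 2 + 1" for n
      proof (cases "n = 0")
        case True
        then show ?thesis by (simp add: c_def floorlog_def)
      next
        case False
        then show ?thesis
          using power_floorlog_le[of "n ^ (2 * k + 3)"] by (simp add: c_def)
      qed
    qed
    note soft_poly_mult[OF this soft_m]
    then have "soft_poly (2 * k + 3 + Suc k + A) (\<lambda>n. 2 ^ c n * m n)"
      by (rule soft_poly_raise) simp
    moreover have "soft_poly (2 * k + 3 + Suc k + A) (\<lambda>n. c n * H n)"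
      by (rule soft_poly_raise[OF soft_poly_mult[OF soft_c soft_H]]) simp
    ultimately have "soft_poly (2 * k + 3 + Suc k + A) N'"
      unfolding N'_def by (rule soft_poly_add[rotated])
    then show "\<exists>A. soft_poly A N'" by blast
  qed
  then show ?thesis by blast
qed

lemma ex_separation: "\<exists>N g a b. separation k N g a b"
proof (induction k)
  case 0
  show ?case using separation_0 by blast
next
  case (Suc k)
  then obtain N g a b where "separation k N g a b" by blast
  then show ?case by (rule separation_Suc)
qed

section \<open>The functions \<open>f\<^sub>k\<close> and the final bounds\<close>

lemma ex_functions:
  "\<exists>(N :: nat \<Rightarrow> nat) (f :: nat \<Rightarrow> (nat \<Rightarrow> bool) \<Rightarrow> bool) M.
     (\<forall>n. f n \<in> bool_funs (N n)) \<and>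
     eventually (\<lambda>n. real (RQ (N n) (f n)) \<ge> real n ^ (2 * k + 1) / ln (real n) ^ M) sequentially \<and>
     soft_poly (k + 1) (\<lambda>n. UC (N n) (f n)) \<and>
     eventually (\<lambda>n. n \<le> UC (N n) (f n)) sequentially"
proof -
  obtain N g a b where sep: "separation k N g a b" using ex_separation[of k] by blast
  note F = separation_nand[OF sep]
  note dep = separation_depends_on[OF sep]
  define N' where "N' = (\<lambda>n. n * N n)"
  define f where "f = (\<lambda>n. restrict (nand n (N n) (g n)) (cube (N' n)))"
  obtain M where M: "eventually (\<lambda>n. hard (n * N n) (nand n (N n) (g n))
       (real n ^ (2 * k + 1) / ln (real n) ^ M) (1 / ln (real n) ^ 1)) sequentially"
    using F(1) unfolding hard_family_def by blast
  have "f n \<in> bool_funs (N' n)" for n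
    by (simp add: f_def bool_funs_def)
  moreover have "eventually (\<lambda>n. real (RQ (N' n) (f n)) \<ge> real n ^ (2 * k + 1) / ln (real n) ^ M)
      sequentially"
    using M eventually_ln_ge[of 4]
  proof eventually_elim
    case (elim n)
    have "1 / ln (real n) ^ 1 < 1 / 3" using elim(2) by (simp add: divide_simps)
    from RQ_ge[OF elim(1) this depends_on_nand[OF dep]]
    show ?case by (simp add: f_def N'_def)
  qed
  moreover have "UC (N' n) (f n) \<le> b n + n * a n" for n
    using UC_side_le[OF F(2)[of n]] UC_side_le[OF F(3)[of n]]
    by (simp add: UC_def f_def N'_def)
  then have "soft_poly (k + 1) (\<lambda>n. UC (N' n) (f n))"
    by (rule soft_poly_le[OF F(6)])
  moreover have "eventually (\<lambda>n. n \<le> UC (N' n) (f n)) sequentially"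
  proof -
    obtain M' where "eventually (\<lambda>n. hard (N n) (g n)
       (real n ^ (2 * k) / ln (real n) ^ M') (1 / ln (real n) ^ 1)) sequentially"
      using sep unfolding separation_def hard_family_def by blast
    then show ?thesis
    proof eventually_elim
      case (elim n)
      then obtain p q where pq: "\<forall>x\<in>set_pmf p. g n x" "\<forall>x\<in>set_pmf q. \<not> g n x"
        unfolding hard_def by blast
      \<comment> \<open>Supports of distributions are nonempty, so hardness already shows that
        \<open>g n\<close> takes both values.\<close>
      obtain x0 x1 where "x1 \<in> set_pmf p" "x0 \<in> set_pmf q"
        using set_pmf_not_empty[of p] set_pmf_not_empty[of q] by blast
      then have "\<not> g n x0" "g n x1" using pq by auto
      from UC_nand_ge[OF dep this F(2)] show ?case by (simp add: f_def N'_def)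
    qed
  qed
  ultimately show ?thesis by blast
qed

theorem theorem6:
  "(\<forall>k::nat. \<exists>(N :: nat \<Rightarrow> nat) (f :: nat \<Rightarrow> (nat \<Rightarrow> bool) \<Rightarrow> bool).
      (\<forall>n\<ge>2. f n \<in> bool_funs (N n)) \<and>
      (\<lambda>n. real (RQ (N n) (f n))) \<in> soft_bigomega (\<lambda>n. real n ^ (2 * k + 1)) \<and>
      (\<lambda>n. real (UC (N n) (f n))) \<in> soft_bigo (\<lambda>n. real n ^ (k + 1)))
   \<and>
   (\<exists>(N :: nat \<Rightarrow> nat) (f :: nat \<Rightarrow> (nat \<Rightarrow> bool) \<Rightarrow> bool) (\<epsilon> :: nat \<Rightarrow> real).
      (\<forall>m. f m \<in> bool_funs (N m)) \<and>
      filterlim (\<lambda>m. UC (N m) (f m)) at_top sequentially \<and>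
      \<epsilon> \<in> o(\<lambda>_. 1) \<and>
      (\<forall>m. real (RQ (N m) (f m)) \<ge> real (UC (N m) (f m)) powr (2 - \<epsilon> m)))"
proof (intro conjI allI)
  fix k :: nat
  obtain N :: "nat \<Rightarrow> nat" and f :: "nat \<Rightarrow> (nat \<Rightarrow> bool) \<Rightarrow> bool" and M where
    f: "\<forall>n. f n \<in> bool_funs (N n)"
    and R: "eventually (\<lambda>n. real (RQ (N n) (f n)) \<ge> real n ^ (2 * k + 1) / ln (real n) ^ M) sequentially"
    and U: "soft_poly (k + 1) (\<lambda>n. UC (N n) (f n))"
    using ex_functions[of k] by blast
  have "(\<lambda>n. real (RQ (N n) (f n))) \<in> \<Omega>(\<lambda>n. real n ^ (2 * k + 1) / ln (real n) ^ M)"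
    using R eventually_ln_ge[of 0]
    by (intro landau_omega.bigI[of 1], simp, eventually_elim) simp
  then have "(\<lambda>n. real (RQ (N n) (f n))) \<in> soft_bigomega (\<lambda>n. real n ^ (2 * k + 1))"
    unfolding soft_bigomega_def by blast
  with f U show "\<exists>(N :: nat \<Rightarrow> nat) (f :: nat \<Rightarrow> (nat \<Rightarrow> bool) \<Rightarrow> bool).
      (\<forall>n\<ge>2. f n \<in> bool_funs (N n)) \<and>
      (\<lambda>n. real (RQ (N n) (f n))) \<in> soft_bigomega (\<lambda>n. real n ^ (2 * k + 1)) \<and>
      (\<lambda>n. real (UC (N n) (f n))) \<in> soft_bigo (\<lambda>n. real n ^ (k + 1))"
    unfolding soft_poly_def by blast
next
  \<comment> \<open>A diagonal sequence: the \<open>m\<close>-th function comes from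
    \<open>k = m\<close> and some large \<open>n\<close>. There \<open>UC\<close> is at most
    \<open>n ^ (m + 2)\<close>, and the nonnegative exponent \<open>2 - 4 / (m + 2)\<close> turns
    this into \<open>n ^ (2 * m)\<close>; the remaining factor \<open>n\<close> of the lower bound
    outweighs \<open>ln n ^ M\<close>. The condition \<open>m <= UC N f\<close> gives
    divergence.\<close>
  define P where "P = (\<lambda>m N (f :: (nat \<Rightarrow> bool) \<Rightarrow> bool). f \<in> bool_funs N \<and> m \<le> UC N f \<and>
    real (RQ N f) \<ge> real (UC N f) powr (2 - 4 / (real m + 2)))"
  have "\<exists>N f. P m N f" for m :: nat
  proof -
    obtain N :: "nat \<Rightarrow> nat" and f :: "nat \<Rightarrow> (nat \<Rightarrow> bool) \<Rightarrow> bool" and M where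
      f: "\<forall>n. f n \<in> bool_funs (N n)"
      and R: "eventually (\<lambda>n. real (RQ (N n) (f n)) \<ge> real n ^ (2 * m + 1) / ln (real n) ^ M) sequentially"
      and U: "soft_poly (m + 1) (\<lambda>n. UC (N n) (f n))"
      and U': "eventually (\<lambda>n. n \<le> UC (N n) (f n)) sequentially"
      using ex_functions[of m] by blast
    have "(\<lambda>n. ln (real n) ^ M) \<in> o(\<lambda>n. real n)" by real_asymp
    then have "eventually (\<lambda>n. norm (ln (real n) ^ M) \<le> 1 * norm (real n)) sequentially"
      by (rule landau_o.smallD) simp
    then have "eventually (\<lambda>n. P m (N n) (f n)) sequentially"
      using R soft_poly_bound[OF U] U' eventually_ln_ge[of 1] eventually_ge_at_top[of "max 2 m"]
    proof eventually_elim
      case (elim n)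
      have n: "n \<ge> 2" "n \<ge> m" using elim(6) by auto
      have "real (UC (N n) (f n)) \<le> real (n ^ (m + 2))"
        using elim(3) by (simp only: of_nat_le_iff) simp
      then have "real (UC (N n) (f n)) powr (2 - 4 / (real m + 2))
          \<le> real (n ^ (m + 2)) powr (2 - 4 / (real m + 2))"
        by (intro powr_mono2) (auto simp: field_simps)
      also have "\<dots> = real n powr (real (m + 2) * (2 - 4 / (real m + 2)))"
        using n by (simp only: of_nat_power powr_realpow [symmetric] powr_powr)
      also have "real (m + 2) * (2 - 4 / (real m + 2)) = real (2 * m)"
        by (simp add: field_simps)
      also have "real n powr real (2 * m) = real n ^ (2 * m)"
        using n by (intro powr_realpow) simp
      also have "\<dots> = real n ^ (2 * m + 1) / real n" using n by simp
      also have "\<dots> \<le> real n ^ (2 * m + 1) / ln (real n) ^ M"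
        using elim(1,5) n by (intro divide_left_mono) auto
      also have "\<dots> \<le> real (RQ (N n) (f n))" by (rule elim(2))
      finally show ?case using f n(2) elim(4) by (auto simp: P_def)
    qed
    from eventually_happens'[OF sequentially_bot this] show ?thesis by blast
  qed
  then obtain N f where P: "\<And>m. P m (N m) (f m)" by metis
  show "\<exists>(N :: nat \<Rightarrow> nat) (f :: nat \<Rightarrow> (nat \<Rightarrow> bool) \<Rightarrow> bool) (\<epsilon> :: nat \<Rightarrow> real).
      (\<forall>m. f m \<in> bool_funs (N m)) \<and>
      filterlim (\<lambda>m. UC (N m) (f m)) at_top sequentially \<and>
      \<epsilon> \<in> o(\<lambda>_. 1) \<and>
      (\<forall>m. real (RQ (N m) (f m)) \<ge> real (UC (N m) (f m)) powr (2 - \<epsilon> m))"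
  proof (intro exI conjI allI)
    show "f m \<in> bool_funs (N m)" for m using P by (simp add: P_def)
    show "filterlim (\<lambda>m. UC (N m) (f m)) at_top sequentially"
      by (rule filterlim_at_top_mono[OF filterlim_ident]) (use P in \<open>auto simp: P_def\<close>)
    show "(\<lambda>m. 4 / (real m + 2)) \<in> o(\<lambda>_. 1)" by real_asymp
    show "real (RQ (N m) (f m)) \<ge> real (UC (N m) (f m)) powr (2 - 4 / (real m + 2))" for m
      using P by (simp add: P_def)
  qed
qed

end
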